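(* The point equivalence class of dual ODEs to a point equivalence class of second order ODEs for which $w_2=0$ and $w_1\neq 0$ has $w_2\neq 0$ and $w_1=0$.
   Context: All considerations are local and concern nonsingular points. For a second order ODE $y''=Q(x,y,y')$, with $Q=Q(x,y,p)$ and $D=\partial_x+p\partial_y+Q\partial_p$, the relative point invariants are $$w_1=D^2Q_{pp}-4DQ_{py}-DQ_{pp}\,Q_p+4Q_pQ_{py}-3Q_{pp}Q_y+6Q_{yy},\qquad w_2=Q_{pppp}.$$ Vanishing or nonvanishing of each is a property invariant under point transformations $(x,y)\mapsto(\tilde x(x,y),\tilde y(x,y))$. For an ODE $Y''=q(X,Y,Y')$, the invariants $w_1,w_2$ are given by the same formulas with $(x,y,p,Q)$ replaced by $(X,Y,P,q)$. Dual ODE: let $y=y(x,X,Y)$ be the general solution of $y''=Q(x,y,y')$, where $X,Y$ are constants of integration. Assume that the relation $y-y(x,X,Y)=0$ can be solved for $Y$, giving $Y=Y(X,x,y)$. Treat $x,y$ as constant parameters and eliminate them by differentiating $Y$ twice with respect to $X$; this yields a second order ODE $\frac{d^2Y}{dX^2}=q\big(X,Y,\frac{dY}{dX}\big)$. Its point equivalence class is uniquely determined by the point equivalence class of $y''=Q(x,y,y')$, and is called the class of ODEs dual to the class of $y''=Q(x,y,y')$. *)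

theory Defs
  imports "HOL-Analysis.Analysis"
begin

definition partial :: "'a::euclidean_space \<Rightarrow> ('a \<Rightarrow> real) \<Rightarrow> 'a \<Rightarrow> real" where
  "partial b f z = frechet_derivative f (at z) b"

primrec Ck_on :: "nat \<Rightarrow> 'a::euclidean_space set \<Rightarrow> ('a \<Rightarrow> real) \<Rightarrow> bool" where
  "Ck_on 0 U f \<longleftrightarrow> continuous_on U f"
| "Ck_on (Suc k) U f \<longleftrightarrow> f differentiable_on U \<and> (\<forall>b\<in>Basis. Ck_on k U (partial b f))"

definition smooth_near :: "('a::euclidean_space \<Rightarrow> real) \<Rightarrow> 'a \<Rightarrow> bool" where
  "smooth_near f z0 \<longleftrightarrow> (\<exists>U. open U \<and> z0 \<in> U \<and> (\<forall>k. Ck_on k U f))"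

abbreviation d1 :: "(real \<times> real \<times> real \<Rightarrow> real) \<Rightarrow> real \<times> real \<times> real \<Rightarrow> real" where
  "d1 \<equiv> partial (1, 0, 0)"

abbreviation d2 :: "(real \<times> real \<times> real \<Rightarrow> real) \<Rightarrow> real \<times> real \<times> real \<Rightarrow> real" where
  "d2 \<equiv> partial (0, 1, 0)"

abbreviation d3 :: "(real \<times> real \<times> real \<Rightarrow> real) \<Rightarrow> real \<times> real \<times> real \<Rightarrow> real" where
  "d3 \<equiv> partial (0, 0, 1)"

text \<open>
  The germ of an equation \<open>y'' = Q(x, y, y')\<close> at a point \<open>(x0, y0, p0)\<close> is represented by the
  pair \<open>(Q, (x0, y0, p0))\<close>; only the values of \<open>Q\<close> near that point matter. The arguments of \<open>Q\<close>
  are ordered as \<open>(x, y, p)\<close>.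
\<close>

type_synonym ode = "(real \<times> real \<times> real \<Rightarrow> real) \<times> (real \<times> real \<times> real)"

definition is_ode :: "ode \<Rightarrow> bool" where
  "is_ode E \<longleftrightarrow> smooth_near (fst E) (snd E)"

definition total_D ::
    "(real \<times> real \<times> real \<Rightarrow> real) \<Rightarrow> (real \<times> real \<times> real \<Rightarrow> real) \<Rightarrow> real \<times> real \<times> real \<Rightarrow> real" where
  "total_D Q g = (\<lambda>(x, y, p). d1 g (x, y, p) + p * d2 g (x, y, p) + Q (x, y, p) * d3 g (x, y, p))"

definition w1 :: "(real \<times> real \<times> real \<Rightarrow> real) \<Rightarrow> real \<times> real \<times> real \<Rightarrow> real" where
  "w1 Q z =
     total_D Q (total_D Q (d3 (d3 Q))) z - 4 * total_D Q (d2 (d3 Q)) z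
     - total_D Q (d3 (d3 Q)) z * d3 Q z + 4 * d3 Q z * d2 (d3 Q) z
     - 3 * d3 (d3 Q) z * d2 Q z + 6 * d2 (d2 Q) z"

definition w2 :: "(real \<times> real \<times> real \<Rightarrow> real) \<Rightarrow> real \<times> real \<times> real \<Rightarrow> real" where
  "w2 Q z = d3 (d3 (d3 (d3 Q))) z"

definition vanishes ::
    "((real \<times> real \<times> real \<Rightarrow> real) \<Rightarrow> real \<times> real \<times> real \<Rightarrow> real) \<Rightarrow> ode \<Rightarrow> bool" where
  "vanishes w E \<longleftrightarrow> (\<forall>\<^sub>F z in nhds (snd E). w (fst E) z = 0)"

definition nowhere_zero ::
    "((real \<times> real \<times> real \<Rightarrow> real) \<Rightarrow> real \<times> real \<times> real \<Rightarrow> real) \<Rightarrow> ode \<Rightarrow> bool" where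
  "nowhere_zero w E \<longleftrightarrow> (\<forall>\<^sub>F z in nhds (snd E). w (fst E) z \<noteq> 0)"

definition along :: "(real \<times> real \<Rightarrow> real) \<Rightarrow> real \<times> real \<times> real \<Rightarrow> real" where
  "along A = (\<lambda>(x, y, p). partial (1, 0) A (x, y) + p * partial (0, 1) A (x, y))"

text \<open>
  A point transformation \<open>(x, y) \<mapsto> (A (x, y), B (x, y))\<close> carries a curve with slope \<open>p\<close> to a curve
  with slope \<open>along B / along A\<close>. If the original curve solves the equation with right-hand side
  \<open>Q\<close>, then the second derivative of the new curve is the total derivative of this slope divided
  by \<open>along A\<close>.
\<close>

definition new_slope ::
    "(real \<times> real \<Rightarrow> real) \<Rightarrow> (real \<times> real \<Rightarrow> real) \<Rightarrow> real \<times> real \<times> real \<Rightarrow> real" where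
  "new_slope A B z = along B z / along A z"

definition prolongation ::
    "(real \<times> real \<Rightarrow> real) \<Rightarrow> (real \<times> real \<Rightarrow> real) \<Rightarrow>
     real \<times> real \<times> real \<Rightarrow> real \<times> real \<times> real" where
  "prolongation A B = (\<lambda>(x, y, p). (A (x, y), B (x, y), new_slope A B (x, y, p)))"

definition point_equivalent :: "ode \<Rightarrow> ode \<Rightarrow> bool" where
  "point_equivalent E E' \<longleftrightarrow>
    is_ode E \<and> is_ode E' \<and>
    (case E of (Q, (x0, y0, p0)) \<Rightarrow> case E' of (Q', z0') \<Rightarrow>
      (\<exists>A B. smooth_near A (x0, y0) \<and> smooth_near B (x0, y0) \<and>
        partial (1, 0) A (x0, y0) * partial (0, 1) B (x0, y0)
          - partial (0, 1) A (x0, y0) * partial (1, 0) B (x0, y0) \<noteq> 0 \<and>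
        along A (x0, y0, p0) \<noteq> 0 \<and>
        prolongation A B (x0, y0, p0) = z0' \<and>
        (\<forall>\<^sub>F z in nhds (x0, y0, p0).
           Q' (prolongation A B z) = total_D Q (new_slope A B) z / along A z)))"

definition point_class :: "ode \<Rightarrow> ode set" where
  "point_class E = {E'. point_equivalent E E'}"

text \<open>
  A general solution \<open>y = f (x, X, Y)\<close> is a family of solutions whose initial data
  \<open>(f, \<partial>f/\<partial>x)\<close> at a fixed \<open>x\<close> depend on the constants \<open>(X, Y)\<close> with nonzero Jacobian.
\<close>

definition general_solution ::
    "ode \<Rightarrow> (real \<times> real \<times> real \<Rightarrow> real) \<Rightarrow> real \<Rightarrow> real \<Rightarrow> bool" where
  "general_solution E f X0 Y0 \<longleftrightarrow>
    (case E of (Q, (x0, y0, p0)) \<Rightarrow>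
      smooth_near f (x0, X0, Y0) \<and>
      f (x0, X0, Y0) = y0 \<and> d1 f (x0, X0, Y0) = p0 \<and>
      d2 f (x0, X0, Y0) * d3 (d1 f) (x0, X0, Y0) - d3 f (x0, X0, Y0) * d2 (d1 f) (x0, X0, Y0) \<noteq> 0 \<and>
      (\<forall>\<^sub>F (x, X, Y) in nhds (x0, X0, Y0).
         d1 (d1 f) (x, X, Y) = Q (x, f (x, X, Y), d1 f (x, X, Y))))"

text \<open>
  Below, \<open>F (X, x, y)\<close> is the solution for \<open>Y\<close> of the relation \<open>y = f (x, X, Y)\<close>. The last condition
  says that \<open>Y = F (X, x, y)\<close>, as a function of \<open>X\<close> with \<open>x, y\<close> as parameters, satisfies
  \<open>Y'' = q (X, Y, Y')\<close>; the parameters can be eliminated because the Jacobian of \<open>(F, \<partial>F/\<partial>X)\<close> with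
  respect to \<open>(x, y)\<close> is nonzero, by the Jacobian condition on \<open>f\<close>.
\<close>

definition dual_ode :: "ode \<Rightarrow> ode \<Rightarrow> bool" where
  "dual_ode E e \<longleftrightarrow>
    is_ode E \<and> is_ode e \<and>
    (case E of (Q, (x0, y0, p0)) \<Rightarrow> case e of (q, (X0, Y0, P0)) \<Rightarrow>
      (\<exists>f F. general_solution E f X0 Y0 \<and>
        smooth_near F (X0, x0, y0) \<and>
        F (X0, x0, y0) = Y0 \<and> d1 F (X0, x0, y0) = P0 \<and>
        (\<forall>\<^sub>F (x, y, X, Y) in nhds (x0, y0, X0, Y0). y = f (x, X, Y) \<longleftrightarrow> Y = F (X, x, y)) \<and>
        (\<forall>\<^sub>F (X, x, y) in nhds (X0, x0, y0).
           d1 (d1 F) (X, x, y) = q (X, F (X, x, y), d1 F (X, x, y)))))"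

definition dual_class :: "ode set \<Rightarrow> ode set" where
  "dual_class C = {e'. \<exists>E\<in>C. \<exists>e. dual_ode E e \<and> e' \<in> point_class e}"

end

theory Submission
  imports Defs
begin

text \<open>
  On the space of \<open>(x, y, p)\<close>, an equation \<open>y'' = Q (x, y, y')\<close> amounts to a pair of line fields: the
  fibres of the projection to \<open>(x, y)\<close>, spanned by \<open>V = \<partial>\<^sub>p\<close>, and the solution curves, spanned by
  \<open>D = \<partial>\<^sub>x + p \<partial>\<^sub>y + Q \<partial>\<^sub>p\<close>. A point transformation prolongs to a local diffeomorphism that
  preserves both line fields (\<open>point_equivalent_imp_line_pair_equiv\<close>). Passing to a dual equation gives
  a local diffeomorphism that exchanges them, since points and solutions exchange their roles
  (\<open>dual_ode_imp_line_pair_equiv\<close>). Equivalence of pairs of line fields is symmetric and transitive.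
  So a member of the dual class is related to the given equation by a local diffeomorphism
  \<open>\<Phi>\<close> that exchanges the line fields, and it is not necessary to know separately that \<open>w1\<close> and \<open>w2\<close>
  are relative invariants of point transformations.

  It remains to see that such a \<open>\<Phi>\<close> turns \<open>w1\<close> into a nonzero multiple of \<open>w2\<close>
  (\<open>w2_dual_multiple_of_w1\<close>). Let \<open>X\<close>, \<open>Y\<close>, \<open>P\<close> be the components of \<open>\<Phi>\<close>. Then \<open>D\<close> annihilates \<open>X\<close> and \<open>Y\<close>,
  and with \<open>e = D P\<close>, \<open>s = V X\<close> the operator \<open>\<partial>\<^sub>P\<close> of the second equation, pulled back, is \<open>D / e\<close>, while its
  right-hand side is \<open>q = (V P) / s\<close>. Applying the commutation relations of \<open>V\<close>, \<open>D\<close> and \<open>U = [V, D]\<close> to \<open>X\<close>, \<open>Y\<close>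
  and \<open>P\<close> gives differential equations for the logarithms of \<open>e\<close> and \<open>s\<close>, which collapse the fourth
  derivative of \<open>q\<close> along \<open>D / e\<close> to \<open>w1 / (e\<^sup>3 s)\<close> (\<open>dual_curvature\<close> and \<open>fourth_derivative_of_dual\<close>). The
  theorem follows by using this for \<open>\<Phi>\<close> and for its inverse.

  The analytic prerequisites are closure properties of smooth functions, the symmetry of mixed
  partial derivatives, and the inverse function theorem in the smooth category.
\<close>

section \<open>Smooth functions\<close>

text \<open>Smoothness on a set, as opposed to smoothness of a germ. The set is always open below.\<close>

definition smooth_on :: "'a::euclidean_space set \<Rightarrow> ('a \<Rightarrow> real) \<Rightarrow> bool" where
  "smooth_on U f \<longleftrightarrow> (\<forall>k. Ck_on k U f)"

lemma smooth_near_iff: "smooth_near f z \<longleftrightarrow> (\<exists>U. open U \<and> z \<in> U \<and> smooth_on U f)"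
  by (simp add: smooth_near_def smooth_on_def)

lemma partial_eq: "(f has_derivative f') (at z) \<Longrightarrow> partial b f z = f' b"
  by (metis frechet_derivative_at partial_def)

lemma has_derivative_partial:
  assumes "f differentiable at z"
  shows "(f has_derivative (\<lambda>v. \<Sum>b\<in>Basis. (v \<bullet> b) * partial b f z)) (at z)"
proof -
  have f: "(f has_derivative frechet_derivative f (at z)) (at z)"
    using assms frechet_derivative_works by blast
  interpret bounded_linear "frechet_derivative f (at z)"
    using f by (rule has_derivative_bounded_linear)
  have "frechet_derivative f (at z) v = (\<Sum>b\<in>Basis. (v \<bullet> b) * partial b f z)" for v
    by (subst euclidean_representation[of v, symmetric], subst sum) (simp add: scaleR partial_def)
  then have "frechet_derivative f (at z) = (\<lambda>v. \<Sum>b\<in>Basis. (v \<bullet> b) * partial b f z)"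
    by blast
  with f show ?thesis
    by simp
qed

lemma partial_cong_open:
  assumes "open U" "z \<in> U" "\<And>w. w \<in> U \<Longrightarrow> f w = g w"
  shows "partial b f z = partial b g z"
proof -
  have "(f has_derivative h) (at z) \<longleftrightarrow> (g has_derivative h) (at z)" for h
    using has_derivative_transform_within_open[of f h z UNIV U g]
      has_derivative_transform_within_open[of g h z UNIV U f] assms by auto
  then show ?thesis
    by (simp add: partial_def frechet_derivative_def)
qed

lemma Ck_on_cong_imp:
  assumes "open U"
  shows "Ck_on k U f \<Longrightarrow> (\<And>w. w \<in> U \<Longrightarrow> f w = g w) \<Longrightarrow> Ck_on k U g"
proof (induction k arbitrary: f g)
  case 0
  then show ?case
    by (simp cong: continuous_on_cong)
next
  case (Suc k)
  have "g differentiable at z" if "z \<in> U" for z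
  proof -
    have "f differentiable at z"
      using Suc.prems(1) assms that by (simp add: differentiable_on_eq_differentiable_at)
    then show ?thesis
      using has_derivative_transform_within_open[where f=f and g=g, OF _ assms that Suc.prems(2)]
      unfolding differentiable_def by blast
  qed
  then have "g differentiable_on U"
    using differentiable_at_imp_differentiable_on by blast
  moreover have "Ck_on k U (partial b g)" if "b \<in> Basis" for b
    using Suc.IH[of "partial b f" "partial b g"] Suc.prems that
      partial_cong_open[OF assms, of _ f g b] by auto
  ultimately show ?case
    by simp
qed

lemma Ck_on_cong:
  assumes "open U" "\<And>w. w \<in> U \<Longrightarrow> f w = g w"
  shows "Ck_on k U f \<longleftrightarrow> Ck_on k U g"
  using Ck_on_cong_imp[OF assms(1), of k f g] Ck_on_cong_imp[OF assms(1), of k g f] assms(2) by auto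

lemma Ck_on_subset: "Ck_on k U f \<Longrightarrow> V \<subseteq> U \<Longrightarrow> Ck_on k V f"
proof (induction k arbitrary: f)
  case 0
  then show ?case using continuous_on_subset by auto
next
  case (Suc k)
  then show ?case using differentiable_on_subset by (simp; blast)
qed

lemma Ck_on_Suc_imp: "Ck_on (Suc k) U f \<Longrightarrow> Ck_on k U f"
proof (induction k arbitrary: f)
  case 0
  then show ?case by (simp add: differentiable_imp_continuous_on)
next
  case (Suc k)
  then have "\<forall>b\<in>Basis. Ck_on k U (partial b f)"
    by (metis Ck_on.simps(2))
  with Suc show ?case by (metis Ck_on.simps(2))
qed

text \<open>A function is of class \<open>C\<^sup>k\<^sup>+\<^sup>1\<close> as soon as its derivative, in whatever form it is known, has
  components of class \<open>C\<^sup>k\<close>. All closure properties below are inductions on \<open>k\<close> through this rule.\<close>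

lemma Ck_on_SucI:
  assumes "open U" "\<And>z. z \<in> U \<Longrightarrow> (f has_derivative f' z) (at z)"
    and "\<And>b. b \<in> Basis \<Longrightarrow> Ck_on k U (\<lambda>z. f' z b)"
  shows "Ck_on (Suc k) U f"
proof -
  have "f differentiable_on U"
    using assms by (metis differentiable_at_imp_differentiable_on differentiable_def)
  moreover have "Ck_on k U (partial b f)" if "b \<in> Basis" for b
    using Ck_on_cong[OF assms(1), of "\<lambda>z. f' z b" "partial b f"] assms(2,3) that partial_eq
    by metis
  ultimately show ?thesis by simp
qed

lemma Ck_on_const: "open U \<Longrightarrow> Ck_on k U (\<lambda>_. c)"
proof (induction k arbitrary: c)
  case (Suc k)
  show ?case
    by (rule Ck_on_SucI[where f'="\<lambda>_ _. 0"]) (use Suc in auto)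
qed simp

lemma Ck_on_inner: "open U \<Longrightarrow> Ck_on k U (\<lambda>z. z \<bullet> i)"
proof (cases k)
  case (Suc k)
  assume "open U"
  then show ?thesis unfolding Suc
    by (intro Ck_on_SucI[where f'="\<lambda>_ v. v \<bullet> i"]) (auto intro!: derivative_eq_intros Ck_on_const)
qed (auto intro!: continuous_intros)

lemma Ck_on_has_derivative:
  assumes "open U" "Ck_on (Suc k) U f" "z \<in> U"
  shows "(f has_derivative (\<lambda>v. \<Sum>b\<in>Basis. (v \<bullet> b) * partial b f z)) (at z)"
  using assms by (intro has_derivative_partial) (auto simp: differentiable_on_eq_differentiable_at)

lemma sum_Basis_partial: "b \<in> Basis \<Longrightarrow> (\<Sum>i\<in>Basis. (b \<bullet> i) * g i) = (g b :: real)"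
  by (simp add: inner_Basis if_distrib[of "\<lambda>x. x * _"] cong: if_cong)

lemma Ck_on_add:
  assumes "open U"
  shows "Ck_on k U f \<Longrightarrow> Ck_on k U g \<Longrightarrow> Ck_on k U (\<lambda>z. f z + g z)"
proof (induction k arbitrary: f g)
  case 0
  then show ?case by (auto intro: continuous_intros)
next
  case (Suc k)
  note d = Ck_on_has_derivative[OF assms Suc.prems(1)] Ck_on_has_derivative[OF assms Suc.prems(2)]
  show ?case
    using Suc by (intro Ck_on_SucI[OF assms has_derivative_add[OF d]]) (auto simp: sum_Basis_partial)
qed

lemma Ck_on_sum:
  assumes "open U" "finite I" "\<And>i. i \<in> I \<Longrightarrow> Ck_on k U (f i)"
  shows "Ck_on k U (\<lambda>z. \<Sum>i\<in>I. f i z)"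
  using assms(2,3)
  by (induction I rule: finite_induct) (auto intro!: Ck_on_const Ck_on_add assms(1))

lemma Ck_on_mult:
  assumes "open U"
  shows "Ck_on k U f \<Longrightarrow> Ck_on k U g \<Longrightarrow> Ck_on k U (\<lambda>z. f z * g z)"
proof (induction k arbitrary: f g)
  case 0
  then show ?case by (auto intro: continuous_intros)
next
  case (Suc k)
  note d = Ck_on_has_derivative[OF assms Suc.prems(1)] Ck_on_has_derivative[OF assms Suc.prems(2)]
  show ?case
    using Suc Ck_on_Suc_imp[OF Suc.prems(1)] Ck_on_Suc_imp[OF Suc.prems(2)]
    by (intro Ck_on_SucI[OF assms has_derivative_mult[OF d]])
      (auto simp: sum_Basis_partial intro!: Ck_on_add assms)
qed

lemma Ck_on_inverse:
  assumes "open U" "\<And>z. z \<in> U \<Longrightarrow> f z \<noteq> 0"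
  shows "Ck_on k U f \<Longrightarrow> Ck_on k U (\<lambda>z. inverse (f z))"
proof (induction k)
  case 0
  then show ?case using assms by (auto intro: continuous_intros)
next
  case (Suc k)
  note d = Ck_on_has_derivative[OF assms(1) Suc.prems]
  have i: "Ck_on k U (\<lambda>z. inverse (f z))"
    using Suc.IH Ck_on_Suc_imp[OF Suc.prems] .
  show ?case
  proof (rule Ck_on_SucI[OF assms(1) Deriv.has_derivative_inverse[OF _ d]])
    fix b :: 'a assume b: "b \<in> Basis"
    then have "Ck_on k U (partial b f)"
      using Suc.prems by simp
    then have "Ck_on k U (\<lambda>z. - 1 * (inverse (f z) * partial b f z * inverse (f z)))"
      by (intro Ck_on_mult[OF assms(1)] Ck_on_const[OF assms(1)] i)
    then show "Ck_on k U (\<lambda>z. - (inverse (f z) * (\<Sum>i\<in>Basis. (b \<bullet> i) * partial i f z) * inverse (f z)))"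
      by (simp add: sum_Basis_partial[OF b])
  qed (use assms in auto)
qed

lemma Ck_on_compose:
  fixes f :: "'b::euclidean_space \<Rightarrow> real" and G :: "'a::euclidean_space \<Rightarrow> 'b"
  assumes "open U" "open W" "\<And>z. z \<in> U \<Longrightarrow> G z \<in> W"
  shows "(\<And>i. i \<in> Basis \<Longrightarrow> Ck_on k U (\<lambda>z. G z \<bullet> i)) \<Longrightarrow> Ck_on k W f \<Longrightarrow> Ck_on k U (\<lambda>z. f (G z))"
proof (induction k arbitrary: f)
  case 0
  have "continuous_on U G"
    using 0 by (subst continuous_on_componentwise) auto
  with 0(2) assms(3) show ?case
    by (simp add: continuous_on_compose2[of W f U G] image_subset_iff)
next
  case (Suc k)
  have G: "(G has_derivative (\<lambda>v. \<Sum>i\<in>Basis. (\<Sum>b\<in>Basis. (v \<bullet> b) * partial b (\<lambda>z. G z \<bullet> i) z) *\<^sub>R i)) (at z)"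
    if "z \<in> U" for z
    by (subst has_derivative_componentwise_within)
      (auto intro: Ck_on_has_derivative[OF assms(1) Suc.prems(1) that])
  note f = Ck_on_has_derivative[OF assms(2) Suc.prems(2)]
  have d: "((\<lambda>z. f (G z)) has_derivative (\<lambda>v. \<Sum>i\<in>Basis. (\<Sum>b\<in>Basis. (v \<bullet> b) * partial b (\<lambda>z. G z \<bullet> i) z)
       * partial i f (G z))) (at z)" if "z \<in> U" for z
    using diff_chain_at[OF G[OF that] f[OF assms(3)[OF that]]] by (simp add: o_def)
  show ?case
  proof (rule Ck_on_SucI[OF assms(1) d])
    fix b :: 'a assume b: "b \<in> Basis"
    have "Ck_on k U (\<lambda>z. partial i f (G z))" if "i \<in> Basis" for i
      using Suc.IH[OF Ck_on_Suc_imp[OF Suc.prems(1)]] Suc.prems(2) that by simp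
    then show "Ck_on k U (\<lambda>z. \<Sum>i\<in>Basis. (\<Sum>b'\<in>Basis. (b \<bullet> b') * partial b' (\<lambda>z. G z \<bullet> i) z) * partial i f (G z))"
      unfolding sum_Basis_partial[OF b] using Suc.prems(1) b
      by (intro Ck_on_sum[OF assms(1)] Ck_on_mult[OF assms(1)]) simp_all
  qed
qed

lemma smooth_on_partial: "smooth_on U f \<Longrightarrow> b \<in> Basis \<Longrightarrow> smooth_on U (partial b f)"
  unfolding smooth_on_def using Ck_on.simps(2) by blast

lemma smooth_on_const: "open U \<Longrightarrow> smooth_on U (\<lambda>_. c)"
  by (simp add: smooth_on_def Ck_on_const)

lemma smooth_on_inner: "open U \<Longrightarrow> smooth_on U (\<lambda>z. z \<bullet> i)"
  by (simp add: smooth_on_def Ck_on_inner)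

lemma smooth_on_add: "open U \<Longrightarrow> smooth_on U f \<Longrightarrow> smooth_on U g \<Longrightarrow> smooth_on U (\<lambda>z. f z + g z)"
  by (simp add: smooth_on_def Ck_on_add)

lemma smooth_on_mult: "open U \<Longrightarrow> smooth_on U f \<Longrightarrow> smooth_on U g \<Longrightarrow> smooth_on U (\<lambda>z. f z * g z)"
  by (simp add: smooth_on_def Ck_on_mult)

lemma smooth_on_minus: "open U \<Longrightarrow> smooth_on U f \<Longrightarrow> smooth_on U (\<lambda>z. - f z)"
  using smooth_on_mult[of U "\<lambda>_. -1" f] smooth_on_const[of U "-1"] by simp

lemma smooth_on_diff: "open U \<Longrightarrow> smooth_on U f \<Longrightarrow> smooth_on U g \<Longrightarrow> smooth_on U (\<lambda>z. f z - g z)"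
  using smooth_on_add[of U f "\<lambda>z. - g z"] smooth_on_minus[of U g] by simp

lemma smooth_on_inverse:
  "open U \<Longrightarrow> (\<And>z. z \<in> U \<Longrightarrow> f z \<noteq> 0) \<Longrightarrow> smooth_on U f \<Longrightarrow> smooth_on U (\<lambda>z. inverse (f z))"
  by (simp add: smooth_on_def Ck_on_inverse)

lemma smooth_on_divide:
  "open U \<Longrightarrow> (\<And>z. z \<in> U \<Longrightarrow> g z \<noteq> 0) \<Longrightarrow> smooth_on U f \<Longrightarrow> smooth_on U g \<Longrightarrow> smooth_on U (\<lambda>z. f z / g z)"
  unfolding divide_inverse by (rule smooth_on_mult[OF _ _ smooth_on_inverse])

lemma smooth_on_compose:
  fixes f :: "'b::euclidean_space \<Rightarrow> real" and G :: "'a::euclidean_space \<Rightarrow> 'b"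
  assumes "open U" "open W" "\<And>z. z \<in> U \<Longrightarrow> G z \<in> W"
    and "\<And>i. i \<in> Basis \<Longrightarrow> smooth_on U (\<lambda>z. G z \<bullet> i)" "smooth_on W f"
  shows "smooth_on U (\<lambda>z. f (G z))"
  unfolding smooth_on_def
proof
  show "Ck_on k U (\<lambda>z. f (G z))" for k
    by (rule Ck_on_compose[OF assms(1-3)]) (use assms(4,5) in \<open>simp_all add: smooth_on_def\<close>)
qed

lemma smooth_on_subset: "smooth_on U f \<Longrightarrow> V \<subseteq> U \<Longrightarrow> smooth_on V f"
  by (auto simp: smooth_on_def intro: Ck_on_subset)

lemma smooth_on_cong:
  "open U \<Longrightarrow> (\<And>w. w \<in> U \<Longrightarrow> f w = g w) \<Longrightarrow> smooth_on U f \<longleftrightarrow> smooth_on U g"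
  by (simp add: smooth_on_def Ck_on_cong[of U f g])

lemma smooth_on_has_derivative:
  assumes "open U" "smooth_on U f" "z \<in> U"
  shows "(f has_derivative (\<lambda>v. \<Sum>b\<in>Basis. (v \<bullet> b) * partial b f z)) (at z)"
  by (rule Ck_on_has_derivative[OF assms(1) _ assms(3), where k=0]) (use assms(2) in \<open>simp only: smooth_on_def\<close>)

lemma smooth_on_continuous: "smooth_on U f \<Longrightarrow> continuous_on U f"
  by (simp only: smooth_on_def Ck_on.simps(1)[symmetric])

lemma smooth_onI:
  assumes "open U" "\<And>z. z \<in> U \<Longrightarrow> (f has_derivative f' z) (at z)"
    and "\<And>b. b \<in> Basis \<Longrightarrow> smooth_on U (\<lambda>z. f' z b)"
  shows "smooth_on U f"
  unfolding smooth_on_def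
proof
  fix k show "Ck_on k U f"
    by (rule Ck_on_Suc_imp, rule Ck_on_SucI[OF assms(1,2)]) (use assms(3) in \<open>auto simp: smooth_on_def\<close>)
qed

lemma has_derivative_half_ln_square:
  fixes f :: "'a::real_normed_vector \<Rightarrow> real"
  assumes "(f has_derivative f') (at z)" "f z \<noteq> 0"
  shows "((\<lambda>z. ln ((f z)\<^sup>2) / 2) has_derivative (\<lambda>v. f' v / f z)) (at z)"
proof -
  have "(f z)\<^sup>2 > 0"
    using assms(2) by simp
  from has_derivative_ln[OF this has_derivative_power[OF assms(1), of 2]]
  have "((\<lambda>z. ln ((f z)\<^sup>2) * (1/2)) has_derivative
      (\<lambda>v. of_nat 2 * f' v * f z ^ (2 - 1) * inverse ((f z)\<^sup>2) * (1/2))) (at z)"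
    by (rule has_derivative_mult_left)
  moreover have "of_nat 2 * f' v * f z ^ (2 - 1) * inverse ((f z)\<^sup>2) * (1/2) = f' v / f z" for v
    using assms(2) by (simp add: field_simps power2_eq_square)
  ultimately show ?thesis
    by simp
qed

text \<open>A nowhere vanishing smooth function \<open>f\<close> has a smooth logarithm of its absolute value, in the
  form \<open>ln (f\<^sup>2) / 2\<close>, which does not depend on the sign of \<open>f\<close>.\<close>

lemma smooth_on_logarithm:
  assumes "open U" "\<And>z. z \<in> U \<Longrightarrow> f z \<noteq> 0" "smooth_on U f"
  obtains l where "smooth_on U l" "\<And>z b. z \<in> U \<Longrightarrow> b \<in> Basis \<Longrightarrow> partial b f z = f z * partial b l z"
proof
  let ?l = "\<lambda>z. ln ((f z)\<^sup>2) / 2"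
  have d: "(?l has_derivative (\<lambda>v. (\<Sum>i\<in>Basis. (v \<bullet> i) * partial i f z) / f z)) (at z)"
    if "z \<in> U" for z
    by (rule has_derivative_half_ln_square[OF smooth_on_has_derivative[OF assms(1,3) that] assms(2)[OF that]])
  show "smooth_on U ?l"
  proof (rule smooth_onI[OF assms(1) d])
    fix b :: 'a assume "b \<in> Basis"
    then show "smooth_on U (\<lambda>z. (\<Sum>i\<in>Basis. (b \<bullet> i) * partial i f z) / f z)"
      using assms by (intro smooth_on_divide) (simp_all add: sum_Basis_partial smooth_on_partial)
  qed
  show "partial b f z = f z * partial b ?l z" if "z \<in> U" "b \<in> Basis" for z b
  proof -
    have "partial b ?l z = partial b f z / f z"
      unfolding partial_eq[OF d[OF that(1)]] sum_Basis_partial[OF that(2)] ..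
    then show ?thesis
      using assms(2)[OF that(1)] by simp
  qed
qed

text \<open>Equality of mixed partial derivatives, by evaluating the second difference of \<open>f\<close> over a
  small parallelogram in two ways with the mean value theorem.\<close>

lemma second_difference:
  fixes f :: "'a::euclidean_space \<Rightarrow> real"
  assumes "open U" "smooth_on U f" "b \<in> Basis" "c \<in> Basis" "h > 0"
    and U: "\<And>s t. 0 \<le> s \<Longrightarrow> s \<le> h \<Longrightarrow> 0 \<le> t \<Longrightarrow> t \<le> h \<Longrightarrow> z + s *\<^sub>R b + t *\<^sub>R c \<in> U"
  obtains s t where "0 \<le> s" "s \<le> h" "0 \<le> t" "t \<le> h"
    "f (z + h *\<^sub>R b + h *\<^sub>R c) - f (z + h *\<^sub>R b) - f (z + h *\<^sub>R c) + f z
       = h * h * partial c (partial b f) (z + s *\<^sub>R b + t *\<^sub>R c)"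
proof -
  have chain: "((\<lambda>t. g (p t)) has_real_derivative partial e g (p t)) (at t)"
    if "smooth_on U g" "p t \<in> U" "(p has_derivative (\<lambda>v. v *\<^sub>R e)) (at t)" "e \<in> Basis" for g p e t
  proof -
    have "((\<lambda>t. g (p t)) has_derivative (\<lambda>v. \<Sum>i\<in>Basis. ((v *\<^sub>R e) \<bullet> i) * partial i g (p t))) (at t)"
      using diff_chain_at[OF that(3) smooth_on_has_derivative[OF assms(1) that(1,2)]] by (simp add: o_def)
    moreover have "(\<Sum>i\<in>Basis. ((v *\<^sub>R e) \<bullet> i) * partial i g (p t)) = partial e g (p t) * v" for v
    proof -
      have "(\<Sum>i\<in>Basis. ((v *\<^sub>R e) \<bullet> i) * partial i g (p t))
          = v * (\<Sum>i\<in>Basis. (e \<bullet> i) * partial i g (p t))"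
        unfolding sum_distrib_left by (intro sum.cong) simp_all
      then show ?thesis
        using sum_Basis_partial[OF that(4), of "\<lambda>i. partial i g (p t)"] by simp
    qed
    ultimately show ?thesis
      by (simp add: has_field_derivative_def)
  qed
  let ?g = "\<lambda>s. f (z + s *\<^sub>R b + h *\<^sub>R c) - f (z + s *\<^sub>R b + 0 *\<^sub>R c)"
  have dg: "(?g has_real_derivative partial b f (z + s *\<^sub>R b + h *\<^sub>R c) - partial b f (z + s *\<^sub>R b + 0 *\<^sub>R c)) (at s)"
    if "0 \<le> s" "s \<le> h" for s
    using that assms
    by (intro DERIV_diff chain[where p="\<lambda>s. z + s *\<^sub>R b + _ *\<^sub>R c"] U) (auto intro!: derivative_eq_intros)
  obtain s where "0 < s" "s < h"
    and g: "?g h - ?g 0 = (h - 0) * (partial b f (z + s *\<^sub>R b + h *\<^sub>R c) - partial b f (z + s *\<^sub>R b + 0 *\<^sub>R c))"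
    using MVT2[OF \<open>h > 0\<close> dg] by blast
  then have s: "0 \<le> s" "s \<le> h"
    by simp_all
  have dk: "((\<lambda>t. partial b f (z + s *\<^sub>R b + t *\<^sub>R c)) has_real_derivative
      partial c (partial b f) (z + s *\<^sub>R b + t *\<^sub>R c)) (at t)" if "0 \<le> t" "t \<le> h" for t
    using that assms s by (intro chain U smooth_on_partial) (auto intro!: derivative_eq_intros)
  obtain t where "0 < t" "t < h"
    and g2: "partial b f (z + s *\<^sub>R b + h *\<^sub>R c) - partial b f (z + s *\<^sub>R b + 0 *\<^sub>R c)
      = (h - 0) * partial c (partial b f) (z + s *\<^sub>R b + t *\<^sub>R c)"
    using MVT2[OF \<open>h > 0\<close> dk] by blast
  then have t: "0 \<le> t" "t \<le> h"
    by simp_all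
  show thesis
    using that[OF s t] g g2 by (simp add: algebra_simps)
qed

lemma partial_commute:
  fixes f :: "'a::euclidean_space \<Rightarrow> real"
  assumes "open U" "smooth_on U f" "b \<in> Basis" "c \<in> Basis" "z \<in> U"
  shows "partial b (partial c f) z = partial c (partial b f) z"
proof -
  let ?g = "partial b (partial c f)" and ?k = "partial c (partial b f)"
  have "continuous_on U ?g" "continuous_on U ?k"
    using assms by (auto intro!: smooth_on_continuous smooth_on_partial)
  then have cont: "isCont ?g z" "isCont ?k z"
    using assms(1,5) by (auto simp: continuous_on_eq_continuous_at)
  have "\<bar>?g z - ?k z\<bar> \<le> e" if "e > 0" for e
  proof -
    have "\<forall>\<^sub>F w in nhds z. dist (?g w) (?g z) < e/2 \<and> dist (?k w) (?k z) < e/2 \<and> w \<in> U"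
      using cont[unfolded isCont_def tendsto_at_iff_tendsto_nhds] that assms(1,5)
      by (intro eventually_conj tendstoD eventually_nhds_in_open) auto
    then obtain d where d: "d > 0" "\<And>w. dist w z < d \<Longrightarrow>
        dist (?g w) (?g z) < e/2 \<and> dist (?k w) (?k z) < e/2 \<and> w \<in> U"
      unfolding eventually_nhds_metric by blast
    define h where "h = d/3"
    have h: "h > 0" using d by (simp add: h_def)
    have near: "dist (z + s *\<^sub>R b' + t *\<^sub>R c') z < d"
      if "0 \<le> s" "s \<le> h" "0 \<le> t" "t \<le> h" "b' \<in> Basis" "c' \<in> Basis" for s t and b' c' :: 'a
    proof -
      have "norm (s *\<^sub>R b' + t *\<^sub>R c') \<le> s + t"
        using norm_triangle_ineq[of "s *\<^sub>R b'" "t *\<^sub>R c'"] that by simp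
      also have "\<dots> < d" using that d(1) by (simp add: h_def)
      finally show ?thesis by (simp add: dist_norm add.assoc)
    qed
    obtain s t where 1: "0 \<le> s" "s \<le> h" "0 \<le> t" "t \<le> h"
      "f (z + h *\<^sub>R b + h *\<^sub>R c) - f (z + h *\<^sub>R b) - f (z + h *\<^sub>R c) + f z
       = h * h * ?k (z + s *\<^sub>R b + t *\<^sub>R c)"
      by (rule second_difference[OF assms(1-4) h, of z]) (use near d(2) assms(3,4) in auto)
    obtain s' t' where 2: "0 \<le> s'" "s' \<le> h" "0 \<le> t'" "t' \<le> h"
      "f (z + h *\<^sub>R c + h *\<^sub>R b) - f (z + h *\<^sub>R c) - f (z + h *\<^sub>R b) + f z
       = h * h * ?g (z + s' *\<^sub>R c + t' *\<^sub>R b)"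
      by (rule second_difference[OF assms(1,2,4,3) h, of z]) (use near d(2) assms(3,4) in auto)
    have "h * h * ?k (z + s *\<^sub>R b + t *\<^sub>R c) = h * h * ?g (z + s' *\<^sub>R c + t' *\<^sub>R b)"
      using 1(5) 2(5) by (simp add: algebra_simps)
    then have "?k (z + s *\<^sub>R b + t *\<^sub>R c) = ?g (z + s' *\<^sub>R c + t' *\<^sub>R b)"
      using h by simp
    moreover have "dist (?k (z + s *\<^sub>R b + t *\<^sub>R c)) (?k z) < e/2"
      "dist (?g (z + s' *\<^sub>R c + t' *\<^sub>R b)) (?g z) < e/2"
      using d(2)[OF near[OF 1(1-4) assms(3,4)]] d(2)[OF near[OF 2(1-4) assms(4,3)]] by blast+
    ultimately show ?thesis
      unfolding dist_real_def by linarith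
  qed
  then have "\<bar>?g z - ?k z\<bar> \<le> 0 + e" if "e > 0" for e
    using that by simp
  then have "\<bar>?g z - ?k z\<bar> \<le> 0"
    by (rule field_le_epsilon)
  then show ?thesis by simp
qed

section \<open>Frames adapted to a second order equation\<close>

text \<open>The computation with vector fields is done with operators on a ring \<open>S\<close> of functions, compared
  only on a set \<open>M\<close>; later \<open>S\<close> consists of the functions that are smooth on the open set \<open>M\<close>.\<close>

locale function_ring =
  fixes S :: "('p \<Rightarrow> real) \<Rightarrow> bool"
  assumes S_const [simp]: "S (\<lambda>_. c)"
    and S_add [simp]: "S f \<Longrightarrow> S g \<Longrightarrow> S (\<lambda>z. f z + g z)"
    and S_mult [simp]: "S f \<Longrightarrow> S g \<Longrightarrow> S (\<lambda>z. f z * g z)"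
begin

lemma S_minus [simp]: "S f \<Longrightarrow> S (\<lambda>z. - f z)"
  using S_mult[OF S_const[of "-1"], of f] by simp

lemma S_diff [simp]: "S f \<Longrightarrow> S g \<Longrightarrow> S (\<lambda>z. f z - g z)"
  using S_add[OF _ S_minus, of f g] by simp

end

text \<open>A vector field, viewed as a derivation of \<open>S\<close>. By \<open>cong\<close> it is local: on \<open>M\<close> it depends only
  on the values on \<open>M\<close>.\<close>

locale derivation = function_ring S
  for M :: "'p set" and S :: "('p \<Rightarrow> real) \<Rightarrow> bool" +
  fixes X :: "('p \<Rightarrow> real) \<Rightarrow> 'p \<Rightarrow> real"
  assumes closed [simp]: "S f \<Longrightarrow> S (X f)"
    and cong: "S f \<Longrightarrow> S g \<Longrightarrow> (\<And>w. w \<in> M \<Longrightarrow> f w = g w) \<Longrightarrow> z \<in> M \<Longrightarrow> X f z = X g z"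
    and const [simp]: "z \<in> M \<Longrightarrow> X (\<lambda>_. c) z = 0"
    and add [simp]: "S f \<Longrightarrow> S g \<Longrightarrow> z \<in> M \<Longrightarrow> X (\<lambda>w. f w + g w) z = X f z + X g z"
    and mult [simp]: "S f \<Longrightarrow> S g \<Longrightarrow> z \<in> M \<Longrightarrow> X (\<lambda>w. f w * g w) z = X f z * g z + f z * X g z"
begin

lemma minus [simp]: "S f \<Longrightarrow> z \<in> M \<Longrightarrow> X (\<lambda>w. - f w) z = - X f z"
  using mult[of "\<lambda>_. -1" f z] by simp

lemma diff [simp]: "S f \<Longrightarrow> S g \<Longrightarrow> z \<in> M \<Longrightarrow> X (\<lambda>w. f w - g w) z = X f z - X g z"
  using add[of f "\<lambda>w. - g w" z] by simp

end

text \<open>The frame attached to \<open>y'' = Q (x, y, y')\<close>: \<open>V = \<partial>\<^sub>p\<close>, \<open>D\<close> is the total derivative and \<open>U = [V, D]\<close>.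
  With \<open>r = Q\<^sub>p\<close>, \<open>a = Q\<^sub>p\<^sub>p\<close> and \<open>k = D Q\<^sub>p - Q\<^sub>y\<close> its structure equations are \<open>[V, U] = a V\<close> and
  \<open>[D, U] = k V - r U\<close>. The rule \<open>Vk\<close> is what the Jacobi identity gives. The rules \<open>VD\<close>, \<open>VU\<close> and
  \<open>UD\<close>, read from left to right, bring iterated derivatives into the normal order \<open>D\<close>, \<open>U\<close>, \<open>V\<close>.\<close>

locale ode_frame = V: derivation M S V + D: derivation M S D + U: derivation M S U
  for M :: "'p set" and S :: "('p \<Rightarrow> real) \<Rightarrow> bool" and V D U +
  fixes a k r :: "'p \<Rightarrow> real"
  assumes S_coeffs [simp]: "S a" "S k" "S r"
    and Vr: "z \<in> M \<Longrightarrow> V r z = a z"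
    and Vk: "z \<in> M \<Longrightarrow> V k z = D a z + r z * a z"
    and VD: "S f \<Longrightarrow> z \<in> M \<Longrightarrow> V (D f) z = D (V f) z + U f z"
    and VU: "S f \<Longrightarrow> z \<in> M \<Longrightarrow> V (U f) z = U (V f) z + a z * V f z"
    and UD: "S f \<Longrightarrow> z \<in> M \<Longrightarrow> U (D f) z = D (U f) z - k z * V f z + r z * U f z"
begin

text \<open>The invariant \<open>w1\<close> in terms of the frame, in normal order.\<close>

definition curvature :: "'p \<Rightarrow> real" where
  "curvature z = D (D a) z + 2 * D (U r) z + 4 * r z * U r z + a z * D r z
     + 3 * r z * D a z + 2 * (r z)\<^sup>2 * a z - 3 * a z * k z - 6 * U k z"

text \<open>The algebraic core. In the next lemma, \<open>t\<close> and \<open>l\<close> are the logarithms of the absolute values of the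
  two factors by which a dual equation rescales \<open>V\<close> and \<open>D\<close>, the three equations assumed for them are
  forced by the structure equations, and \<open>m\<close> is, up to a factor, the derivative of the dual
  right-hand side with respect to \<open>P\<close>. Besides \<open>a\<close> and \<open>r\<close>, the second order expression \<open>L\<close> in \<open>m\<close> then
  involves only \<open>p = D t\<close> and its first derivatives; as \<open>p\<close> solves the Riccati equation
  \<open>D p = - p\<^sup>2 - r p - k\<close>, one more derivative makes \<open>p\<close> disappear altogether.\<close>

lemma dual_curvature:
  assumes S: "S l" "S t"
    and l: "\<And>z. z \<in> M \<Longrightarrow> D l z = - r z - 2 * D t z"
    and t: "\<And>z. z \<in> M \<Longrightarrow> D (D t) z = - (D t z * D t z) - r z * D t z - k z"
    and tV: "\<And>z. z \<in> M \<Longrightarrow> D (V t) z = - 2 * U t z - V t z * D t z - a z"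
    and z: "z \<in> M"
  defines "m \<equiv> \<lambda>z. 2 * V l z + V t z"
  defines "L \<equiv> \<lambda>z. D (D m) z + r z * D m z + k z * m z"
  shows "D L z + (2 * r z + 3 * D t z) * L z = curvature z"
proof -
  note S [simp]
  have DVl: "D (V l) z = - a z - 2 * V (D t) z - U l z" if z: "z \<in> M" for z
  proof -
    have "V (D l) z = V (\<lambda>z. - r z - 2 * D t z) z"
      by (rule V.cong) (use z l in simp_all)
    with z show ?thesis
      by (simp add: VD Vr)
  qed
  have DUl: "D (U l) z = - U r z - 2 * U (D t) z + k z * V l z - r z * U l z" if z: "z \<in> M" for z
  proof -
    have "U (D l) z = U (\<lambda>z. - r z - 2 * D t z) z"
      by (rule U.cong) (use z l in simp_all)
    with z show ?thesis
      by (simp add: UD)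
  qed
  have Dm: "D m z = a z + 2 * U t z - 2 * U l z + 3 * V t z * D t z" if z: "z \<in> M" for z
    using z by (simp add: m_def DVl VD tV algebra_simps)
  have DDm: "D (D m) z = D a z + 2 * D (U t) z - 2 * D (U l) z
      + 3 * D (V t) z * D t z + 3 * V t z * D (D t) z" if z: "z \<in> M" for z
  proof -
    have "D (D m) z = D (\<lambda>z. a z + 2 * U t z - 2 * U l z + 3 * V t z * D t z) z"
      by (rule D.cong) (use z Dm in \<open>simp_all add: m_def\<close>)
    with z show ?thesis
      by simp
  qed
  define p where "p = D t"
  have [simp]: "S p" by (simp add: p_def)
  have L: "L z = D a z + 2 * U r z + r z * a z + 6 * U p z + 6 * p z * V p z + 3 * a z * p z"
    if z: "z \<in> M" for z
    using z unfolding L_def DDm[OF z] Dm[OF z] DUl[OF z] tV[OF z] t[OF z] p_def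
    by (simp add: UD VD tV m_def algebra_simps)
  have Dp: "D p z = - (p z * p z) - r z * p z - k z" if z: "z \<in> M" for z
    using t[OF z] by (simp add: p_def)
  have DVp: "D (V p) z = - 2 * p z * V p z - r z * V p z - a z * p z - V k z - U p z"
  proof -
    have "V (D p) z = V (\<lambda>z. - (p z * p z) - r z * p z - k z) z"
      by (rule V.cong) (use z Dp in simp_all)
    with z show ?thesis
      by (simp add: VD Vr algebra_simps)
  qed
  have DUp: "D (U p) z = - 2 * p z * U p z - U r z * p z - 2 * r z * U p z - U k z + k z * V p z"
  proof -
    have "U (D p) z = U (\<lambda>z. - (p z * p z) - r z * p z - k z) z"
      by (rule U.cong) (use z Dp in simp_all)
    with z show ?thesis
      by (simp add: UD algebra_simps)
  qed
  have "D L z = D (\<lambda>z. D a z + 2 * U r z + r z * a z + 6 * U p z + 6 * p z * V p z + 3 * a z * p z) z"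
    by (rule D.cong) (use z L in \<open>simp_all add: L_def m_def\<close>)
  also have "\<dots> = D (D a) z + 2 * D (U r) z + D r z * a z + r z * D a z
      + 6 * D (U p) z + 6 * D p z * V p z + 6 * p z * D (V p) z + 3 * D a z * p z + 3 * a z * D p z"
    using z by simp
  finally show ?thesis
    unfolding L[OF z] DUp DVp Dp[OF z] Vk[OF z] curvature_def p_def[symmetric]
    by (simp add: algebra_simps power2_eq_square)
qed

text \<open>Here \<open>(X, Y, P)\<close> are the coordinates of the dual equation, \<open>q\<close> is its right-hand side, and the
  roles of the two line fields are exchanged: \<open>W = D / e\<close> is the dual \<open>\<partial>\<^sub>P\<close> and \<open>V / s\<close> is the dual total
  derivative. So \<open>W (W (W (W q)))\<close> is the invariant \<open>w2\<close> of the dual equation.\<close>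

lemma fourth_derivative_of_dual:
  assumes S: "S X" "S Y" "S P" "S q" "S l" "S t" "S i" "S j" "S s" "S e"
    and X: "\<And>z. z \<in> M \<Longrightarrow> D X z = 0" "\<And>z. z \<in> M \<Longrightarrow> V X z = s z"
    and Y: "\<And>z. z \<in> M \<Longrightarrow> D Y z = 0" "\<And>z. z \<in> M \<Longrightarrow> V Y z = P z * s z"
    and P: "\<And>z. z \<in> M \<Longrightarrow> D P z = e z" "\<And>z. z \<in> M \<Longrightarrow> V P z = q z * s z"
    and e: "\<And>z. z \<in> M \<Longrightarrow> V e z = e z * V l z" "\<And>z. z \<in> M \<Longrightarrow> D e z = e z * D l z"
    and s: "\<And>z. z \<in> M \<Longrightarrow> V s z = s z * V t z" "\<And>z. z \<in> M \<Longrightarrow> D s z = s z * D t z"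
      "\<And>z. z \<in> M \<Longrightarrow> U s z = s z * U t z"
    and i: "\<And>z. z \<in> M \<Longrightarrow> i z * e z = 1" and j: "\<And>z. z \<in> M \<Longrightarrow> j z * s z = 1"
    and z: "z \<in> M"
  defines "W \<equiv> \<lambda>f z. i z * D f z"
  shows "W (W (W (W q))) z = i z * i z * i z * j z * curvature z"
proof -
  note S [simp]
  have W: "W g z = i z * D g z" for g z
    by (simp add: W_def)
  have [simp]: "S (W g)" if "S g" for g
    using that by (simp add: W_def)
  have nz: "s z \<noteq> 0" "e z \<noteq> 0" if "z \<in> M" for z
    using i[OF that] j[OF that] by auto
  \<comment> \<open>\<open>U = [V, D]\<close> applied to \<open>X\<close> and to \<open>Y\<close>\<close>
  have UX: "U X z = - (s z * D t z)" if z: "z \<in> M" for z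
  proof -
    have "V (D X) z = V (\<lambda>_. 0) z" "D (V X) z = D s z"
      by (rule V.cong D.cong; use z X in simp)+
    with z VD[of X z] show ?thesis
      by (simp add: s)
  qed
  have UY: "U Y z = - (e z * s z + P z * s z * D t z)" if z: "z \<in> M" for z
  proof -
    have "V (D Y) z = V (\<lambda>_. 0) z" "D (V Y) z = D (\<lambda>z. P z * s z) z"
      by (rule V.cong D.cong; use z Y in simp)+
    with z VD[of Y z] show ?thesis
      by (simp add: s P)
  qed
  \<comment> \<open>the equation for \<open>[D, U]\<close> applied to \<open>X\<close>\<close>
  have t: "D (D t) z = - (D t z * D t z) - r z * D t z - k z" if z: "z \<in> M" for z
  proof -
    have "U (D X) z = U (\<lambda>_. 0) z" "D (U X) z = D (\<lambda>z. - (s z * D t z)) z"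
      by (rule U.cong D.cong; use z X UX in simp)+
    with z UD[of X z] have "s z * (D (D t) z + D t z * D t z + r z * D t z + k z) = 0"
      by (simp add: s X UX algebra_simps)
    with nz[OF z] show ?thesis
      by simp
  qed
  \<comment> \<open>the equation for \<open>[D, U]\<close> applied to \<open>Y\<close>\<close>
  have l: "D l z = - r z - 2 * D t z" if z: "z \<in> M" for z
  proof -
    have "U (D Y) z = U (\<lambda>_. 0) z" "D (U Y) z = D (\<lambda>z. - (e z * s z + P z * s z * D t z)) z"
      by (rule U.cong D.cong; use z Y UY in simp)+
    with z UD[of Y z] have "e z * s z * (D l z + r z + 2 * D t z) = 0"
      by (simp add: s e P Y UY t algebra_simps)
    with nz[OF z] show ?thesis
      by simp
  qed
  \<comment> \<open>the equation for \<open>[V, U]\<close> applied to \<open>X\<close>\<close>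
  have tV: "D (V t) z = - 2 * U t z - V t z * D t z - a z" if z: "z \<in> M" for z
  proof -
    have "U (V X) z = U s z" "V (U X) z = V (\<lambda>z. - (s z * D t z)) z"
      by (rule U.cong V.cong; use z X UX in simp)+
    with z VU[of X z] have "s z * (D (V t) z + 2 * U t z + V t z * D t z + a z) = 0"
      by (simp add: s X VD algebra_simps)
    with nz[OF z] show ?thesis
      by simp
  qed
  define m where "m = (\<lambda>z. 2 * V l z + V t z)"
  define L where "L = (\<lambda>z. D (D m) z + r z * D m z + k z * m z)"
  have [simp]: "S m" "S L"
    by (simp_all add: m_def L_def)
  \<comment> \<open>the equation for \<open>[V, U]\<close> applied to \<open>Y\<close>\<close>
  have UP: "U P z = - (e z * (V l z + V t z)) - q z * s z * D t z" if z: "z \<in> M" for z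
  proof -
    have "U (V Y) z = U (\<lambda>z. P z * s z) z" "V (U Y) z = V (\<lambda>z. - (e z * s z + P z * s z * D t z)) z"
      by (rule U.cong V.cong; use z Y UY in simp)+
    with z VU[of Y z] have "s z * (U P z + e z * (V l z + V t z) + q z * s z * D t z) = 0"
      by (simp add: s e P Y VD tV algebra_simps)
    with nz[OF z] show ?thesis
      by simp
  qed
  \<comment> \<open>\<open>U = [V, D]\<close> applied to \<open>P\<close>\<close>
  have Dq: "s z * D q z = e z * m z" if z: "z \<in> M" for z
  proof -
    have "V (D P) z = V e z" "D (V P) z = D (\<lambda>z. q z * s z) z"
      by (rule V.cong D.cong; use z P in simp)+
    with z VD[of P z] show ?thesis
      by (simp add: s e UP m_def algebra_simps)
  qed
  have Di: "D i z = - i z * D l z" if z: "z \<in> M" for z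
  proof -
    have "D (\<lambda>z. i z * e z) z = D (\<lambda>_. 1) z"
      by (rule D.cong; use z i in simp)
    with z have "e z * (D i z + i z * D l z) = 0"
      by (simp add: e algebra_simps)
    with nz[OF z] show ?thesis
      by simp
  qed
  have Dj: "D j z = - j z * D t z" if z: "z \<in> M" for z
  proof -
    have "D (\<lambda>z. j z * s z) z = D (\<lambda>_. 1) z"
      by (rule D.cong; use z j in simp)
    with z have "s z * (D j z + j z * D t z) = 0"
      by (simp add: s algebra_simps)
    with nz[OF z] show ?thesis
      by simp
  qed
  have W1: "W q z = m z * j z" if z: "z \<in> M" for z
  proof -
    have "W q z = (i z * (s z * D q z)) * j z"
      using j[OF z] by (simp add: W_def algebra_simps)
    also have "\<dots> = (i z * e z) * (m z * j z)"
      by (simp add: Dq[OF z])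
    finally show ?thesis
      using i[OF z] by simp
  qed
  have W2: "W (W q) z = i z * j z * (D m z - m z * D t z)" if z: "z \<in> M" for z
  proof -
    have "D (W q) z = D (\<lambda>z. m z * j z) z"
      by (rule D.cong; use z W1 in simp)
    with z have "D (W q) z = j z * (D m z - m z * D t z)"
      by (simp add: Dj algebra_simps)
    then show ?thesis
      by (simp add: W)
  qed
  have W3: "W (W (W q)) z = i z * i z * j z * L z" if z: "z \<in> M" for z
  proof -
    have "D (W (W q)) z = D (\<lambda>z. i z * j z * (D m z - m z * D t z)) z"
      by (rule D.cong; use z W2 in simp)
    with z have "D (W (W q)) z = i z * j z * L z"
      unfolding L_def by (simp add: Di Dj l t algebra_simps)
    then show ?thesis
      by (simp add: W)
  qed
  have "D (W (W (W q))) z = D (\<lambda>z. i z * i z * j z * L z) z"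
    by (rule D.cong; use z W3 in simp)
  with z have "D (W (W (W q))) z = i z * i z * j z * (D L z + (2 * r z + 3 * D t z) * L z)"
    by (simp add: Di Dj l algebra_simps)
  then have "W (W (W (W q))) z = i z * i z * i z * j z * (D L z + (2 * r z + 3 * D t z) * L z)"
    by (simp add: W)
  then show ?thesis
    using dual_curvature[OF \<open>S l\<close> \<open>S t\<close> l t tV z] by (simp add: L_def m_def)
qed

end

section \<open>Local diffeomorphisms and pairs of line fields\<close>

text \<open>A map into a Euclidean space is smooth if its components are.\<close>

definition smooth_map_on :: "'a::euclidean_space set \<Rightarrow> ('a \<Rightarrow> 'b::euclidean_space) \<Rightarrow> bool" where
  "smooth_map_on M \<Phi> \<longleftrightarrow> (\<forall>i\<in>Basis. smooth_on M (\<lambda>z. \<Phi> z \<bullet> i))"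

lemma smooth_map_on_subset: "smooth_map_on M \<Phi> \<Longrightarrow> N \<subseteq> M \<Longrightarrow> smooth_map_on N \<Phi>"
  unfolding smooth_map_on_def using smooth_on_subset by blast

lemma smooth_map_on_has_derivative:
  fixes \<Phi> :: "'a::euclidean_space \<Rightarrow> 'b::euclidean_space"
  assumes "open M" "smooth_map_on M \<Phi>" "z \<in> M"
  shows "(\<Phi> has_derivative (\<lambda>v. \<Sum>i\<in>Basis. (\<Sum>b\<in>Basis. (v \<bullet> b) * partial b (\<lambda>z. \<Phi> z \<bullet> i) z) *\<^sub>R i)) (at z)"
proof (subst has_derivative_componentwise_within, intro ballI)
  fix i :: 'b assume "i \<in> Basis"
  then have "smooth_on M (\<lambda>z. \<Phi> z \<bullet> i)"
    using assms(2) by (simp add: smooth_map_on_def)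
  from smooth_on_has_derivative[OF assms(1) this assms(3)] \<open>i \<in> Basis\<close>
  show "((\<lambda>z. \<Phi> z \<bullet> i) has_derivative
      (\<lambda>v. (\<Sum>i\<in>Basis. (\<Sum>b\<in>Basis. (v \<bullet> b) * partial b (\<lambda>z. \<Phi> z \<bullet> i) z) *\<^sub>R i) \<bullet> i)) (at z)"
    by simp
qed

lemma smooth_map_on_differentiable:
  assumes "open M" "smooth_map_on M \<Phi>" "z \<in> M"
  shows "\<Phi> differentiable at z"
  unfolding differentiable_def by (rule exI, rule smooth_map_on_has_derivative[OF assms])

lemma smooth_map_on_continuous: "open M \<Longrightarrow> smooth_map_on M \<Phi> \<Longrightarrow> continuous_on M \<Phi>"
  by (rule continuous_at_imp_continuous_on, rule ballI, rule differentiable_imp_continuous_within,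
      rule smooth_map_on_differentiable)

lemma smooth_map_on_compose_fun:
  assumes "open M" "open N" "smooth_map_on M \<Phi>" "\<And>z. z \<in> M \<Longrightarrow> \<Phi> z \<in> N" "smooth_on N f"
  shows "smooth_on M (\<lambda>z. f (\<Phi> z))"
  by (rule smooth_on_compose[OF assms(1,2,4) _ assms(5)]) (use assms(3) in \<open>simp_all add: smooth_map_on_def\<close>)

lemma smooth_map_on_compose:
  assumes "open M" "open N" "smooth_map_on M \<Phi>" "\<And>z. z \<in> M \<Longrightarrow> \<Phi> z \<in> N" "smooth_map_on N \<Psi>"
  shows "smooth_map_on M (\<lambda>z. \<Psi> (\<Phi> z))"
  unfolding smooth_map_on_def
proof
  fix i :: 'c assume "i \<in> Basis"
  then show "smooth_on M (\<lambda>z. \<Psi> (\<Phi> z) \<bullet> i)"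
    using smooth_map_on_compose_fun[OF assms(1-4), of "\<lambda>w. \<Psi> w \<bullet> i"] assms(5)
    by (simp add: smooth_map_on_def)
qed

lemma open_vimage_Int:
  assumes "open M" "continuous_on M \<Phi>" "open N"
  shows "open {z \<in> M. \<Phi> z \<in> N}"
  using continuous_open_preimage[OF assms(2,1,3)] by (simp add: vimage_def Int_def)

text \<open>The version of \<open>smooth_map_on\<close> for germs.\<close>

definition smooth_map_near :: "('a::euclidean_space \<Rightarrow> 'b::euclidean_space) \<Rightarrow> 'a \<Rightarrow> bool" where
  "smooth_map_near \<Phi> z \<longleftrightarrow> (\<exists>M. open M \<and> z \<in> M \<and> smooth_map_on M \<Phi>)"

lemma smooth_map_near_eventually_differentiable:
  assumes "smooth_map_near \<Phi> z"
  shows "\<forall>\<^sub>F x in nhds z. \<Phi> differentiable at x"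
proof -
  obtain M where M: "open M" "z \<in> M" "smooth_map_on M \<Phi>"
    using assms smooth_map_near_def by blast
  then show ?thesis
    using smooth_map_on_differentiable[OF M(1,3)] unfolding eventually_nhds by blast
qed

lemma smooth_map_near_tendsto:
  assumes "smooth_map_near \<Phi> z"
  shows "filterlim \<Phi> (nhds (\<Phi> z)) (nhds z)"
proof -
  obtain M where M: "open M" "z \<in> M" "smooth_map_on M \<Phi>"
    using assms smooth_map_near_def by blast
  then have "isCont \<Phi> z"
    using smooth_map_on_continuous[OF M(1,3)] by (simp add: continuous_on_eq_continuous_at)
  then show ?thesis
    by (simp add: isCont_def tendsto_at_iff_tendsto_nhds)
qed

lemma smooth_map_near_compose:
  assumes "smooth_map_near \<Phi> z" "smooth_map_near \<Psi> (\<Phi> z)"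
  shows "smooth_map_near (\<lambda>x. \<Psi> (\<Phi> x)) z"
proof -
  obtain M where M: "open M" "z \<in> M" "smooth_map_on M \<Phi>"
    using assms(1) smooth_map_near_def by blast
  obtain N where N: "open N" "\<Phi> z \<in> N" "smooth_map_on N \<Psi>"
    using assms(2) smooth_map_near_def by blast
  let ?M = "{x \<in> M. \<Phi> x \<in> N}"
  have o: "open ?M"
    by (rule open_vimage_Int[OF M(1) smooth_map_on_continuous[OF M(1,3)] N(1)])
  have "smooth_map_on ?M (\<lambda>x. \<Psi> (\<Phi> x))"
    by (rule smooth_map_on_compose[OF o N(1) smooth_map_on_subset[OF M(3)] _ N(3)]) auto
  with o M N show ?thesis
    unfolding smooth_map_near_def by blast
qed

text \<open>\<open>\<Phi>\<close> and \<open>\<Xi>\<close> are mutually inverse smooth maps between neighbourhoods of \<open>z\<close> and \<open>w\<close>.\<close>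

definition local_diffeo ::
    "('a::euclidean_space \<Rightarrow> 'a) \<Rightarrow> ('a \<Rightarrow> 'a) \<Rightarrow> 'a \<Rightarrow> 'a \<Rightarrow> bool" where
  "local_diffeo \<Phi> \<Xi> z w \<longleftrightarrow> \<Phi> z = w \<and> \<Xi> w = z \<and> smooth_map_near \<Phi> z \<and> smooth_map_near \<Xi> w \<and>
    (\<forall>\<^sub>F x in nhds z. \<Xi> (\<Phi> x) = x) \<and> (\<forall>\<^sub>F y in nhds w. \<Phi> (\<Xi> y) = y)"

lemma local_diffeo_sym: "local_diffeo \<Phi> \<Xi> z w \<Longrightarrow> local_diffeo \<Xi> \<Phi> w z"
  by (auto simp: local_diffeo_def)

lemma local_diffeo_filterlim: "local_diffeo \<Phi> \<Xi> z w \<Longrightarrow> filterlim \<Phi> (nhds w) (nhds z)"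
  using smooth_map_near_tendsto unfolding local_diffeo_def by blast

lemma local_diffeo_trans:
  assumes "local_diffeo \<Phi> \<Xi> z w" "local_diffeo \<Psi> \<Theta> w v"
  shows "local_diffeo (\<lambda>x. \<Psi> (\<Phi> x)) (\<lambda>y. \<Xi> (\<Theta> y)) z v"
proof -
  note A = assms(1)[unfolded local_diffeo_def] and B = assms(2)[unfolded local_diffeo_def]
  have "\<forall>\<^sub>F x in nhds z. \<Theta> (\<Psi> (\<Phi> x)) = \<Phi> x"
    by (rule eventually_compose_filterlim[where P="\<lambda>y. \<Theta> (\<Psi> y) = y", OF _ local_diffeo_filterlim[OF assms(1)]])
      (use B in blast)
  moreover have "\<forall>\<^sub>F x in nhds z. \<Xi> (\<Phi> x) = x"
    using A by blast
  ultimately have 1: "\<forall>\<^sub>F x in nhds z. \<Xi> (\<Theta> (\<Psi> (\<Phi> x))) = x"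
    by eventually_elim simp
  have "\<forall>\<^sub>F y in nhds v. \<Phi> (\<Xi> (\<Theta> y)) = \<Theta> y"
    by (rule eventually_compose_filterlim[where P="\<lambda>y. \<Phi> (\<Xi> y) = y",
          OF _ local_diffeo_filterlim[OF local_diffeo_sym[OF assms(2)]]]) (use A in blast)
  moreover have "\<forall>\<^sub>F y in nhds v. \<Psi> (\<Theta> y) = y"
    using B by blast
  ultimately have 2: "\<forall>\<^sub>F y in nhds v. \<Psi> (\<Phi> (\<Xi> (\<Theta> y))) = y"
    by eventually_elim simp
  have 3: "smooth_map_near (\<lambda>x. \<Psi> (\<Phi> x)) z"
    by (rule smooth_map_near_compose[of \<Phi> z \<Psi>]) (use A B in simp_all)
  have 4: "smooth_map_near (\<lambda>y. \<Xi> (\<Theta> y)) v"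
    by (rule smooth_map_near_compose[of \<Theta> v \<Xi>]) (use A B in simp_all)
  have "\<Psi> (\<Phi> z) = v" "\<Xi> (\<Theta> v) = z"
    using A B by simp_all
  with 1 2 3 4 show ?thesis
    unfolding local_diffeo_def by blast
qed

text \<open>A differentiable map \<open>g\<close> whose derivative is a smooth function of \<open>g\<close> itself is smooth: each
  degree of smoothness of \<open>g\<close> gives the next one.\<close>

lemma smooth_inverse_map:
  fixes g :: "'a::euclidean_space \<Rightarrow> 'b::euclidean_space"
  assumes "open V" "open M" "\<And>y. y \<in> V \<Longrightarrow> g y \<in> M"
    and g: "\<And>y. y \<in> V \<Longrightarrow> (g has_derivative g' y) (at y)"
    and K: "\<And>y b. y \<in> V \<Longrightarrow> b \<in> Basis \<Longrightarrow> g' y b = K b (g y)"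
    and KM: "\<And>b. b \<in> Basis \<Longrightarrow> smooth_map_on M (K b)"
  shows "smooth_map_on V g"
proof -
  have "\<forall>i\<in>Basis. Ck_on k V (\<lambda>y. g y \<bullet> i)" for k
  proof (induction k)
    case 0
    have "continuous_on V g"
      by (intro continuous_at_imp_continuous_on ballI has_derivative_continuous[OF g])
    then show ?case
      by (simp add: continuous_on_inner)
  next
    case (Suc k)
    show ?case
    proof
      fix i :: 'b assume i: "i \<in> Basis"
      show "Ck_on (Suc k) V (\<lambda>y. g y \<bullet> i)"
      proof (rule Ck_on_SucI[OF assms(1)])
        show "((\<lambda>y. g y \<bullet> i) has_derivative (\<lambda>v. g' y v \<bullet> i)) (at y)" if "y \<in> V" for y
          by (rule has_derivative_inner_left[OF g[OF that]])
        fix b :: 'a assume b: "b \<in> Basis"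
        have "Ck_on k M (\<lambda>w. K b w \<bullet> i)"
          using KM[OF b] i by (simp add: smooth_map_on_def smooth_on_def)
        then have "Ck_on k V (\<lambda>y. K b (g y) \<bullet> i)"
          using Suc.IH by (rule_tac Ck_on_compose[OF assms(1-3), where f="\<lambda>w. K b w \<bullet> i"]) simp_all
        then show "Ck_on k V (\<lambda>y. g' y b \<bullet> i)"
          by (rule Ck_on_cong_imp[OF assms(1)]) (simp add: K[OF _ b])
      qed
    qed
  qed
  then show ?thesis
    by (simp add: smooth_map_on_def smooth_on_def)
qed

text \<open>The inverse function theorem for smooth maps. The inverse of the derivative of \<open>\<Phi>\<close> is supplied by
  the smooth vector fields \<open>K b\<close>, which \<open>\<Phi>\<close> sends to the basis vectors \<open>b\<close>.\<close>

lemma smooth_inverse_function: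
  fixes \<Phi> :: "'a::euclidean_space \<Rightarrow> 'a"
  assumes M: "open M" "z0 \<in> M" and \<Phi>: "smooth_map_on M \<Phi>"
    and K: "\<And>z b. z \<in> M \<Longrightarrow> b \<in> Basis \<Longrightarrow> frechet_derivative \<Phi> (at z) (K b z) = b"
    and KM: "\<And>b. b \<in> Basis \<Longrightarrow> smooth_map_on M (K b)"
  obtains \<Xi> where "local_diffeo \<Phi> \<Xi> z0 (\<Phi> z0)"
proof -
  define f' where "f' z = blinfun_of_matrix (\<lambda>i b. partial b (\<lambda>z. \<Phi> z \<bullet> i) z)" for z
  have der: "(\<Phi> has_derivative blinfun_apply (f' z)) (at z)" if "z \<in> M" for z
    using smooth_map_on_has_derivative[OF M(1) \<Phi> that]
    by (simp add: f'_def blinfun_of_matrix_apply[abs_def] scaleR_sum_left)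
  have f'K: "f' z (K b z) = b" if "z \<in> M" "b \<in> Basis" for z b
    using K[OF that] frechet_derivative_at[OF der[OF that(1)]] by simp
  have cont: "continuous_on M f'"
    unfolding f'_def using \<Phi>
    by (intro continuous_on_blinfun_of_matrix smooth_on_continuous smooth_on_partial)
      (simp_all add: smooth_map_on_def)
  define h where "h v = (\<Sum>b\<in>Basis. (v \<bullet> b) *\<^sub>R K b z0)" for v
  have lin: "linear h"
    by (rule linearI) (simp_all add: h_def inner_add_left scaleR_add_left sum.distrib scaleR_sum_right)
  have "f' z0 (h v) = v" for v
    using M(2) by (simp add: h_def blinfun.sum_right blinfun.scaleR_right f'K euclidean_representation)
  then have "blinfun_apply (f' z0) \<circ> h = id"
    by auto
  moreover have "linear (blinfun_apply (f' z0))"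
    by (rule bounded_linear.linear[OF blinfun.bounded_linear_right])
  ultimately have hf: "h \<circ> blinfun_apply (f' z0) = id"
    using lin linear_inverse_left[of "blinfun_apply (f' z0)" h] by (simp only: linear_linear)
  have inv: "Blinfun h o\<^sub>L f' z0 = id_blinfun"
    using hf lin by (intro blinfun_eqI)
      (simp add: bounded_linear_Blinfun_apply linear_conv_bounded_linear[symmetric] o_def fun_eq_iff)
  obtain U V g g' where U: "open U" "U \<subseteq> M" "z0 \<in> U" and V: "open V" "\<Phi> z0 \<in> V"
    and hom: "homeomorphism U V \<Phi> g"
    and g: "\<And>y. y \<in> V \<Longrightarrow> (g has_derivative (g' y)) (at y)"
    and g': "\<And>y. y \<in> V \<Longrightarrow> g' y = inv (blinfun_apply (f' (g y)))"
    and bij: "\<And>y. y \<in> V \<Longrightarrow> bij (blinfun_apply (f' (g y)))"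
    using inverse_function_theorem[OF M(1) der cont M(2) inv] by blast
  have gV: "g y \<in> M" if "y \<in> V" for y
    using homeomorphism_image2[OF hom] U(2) that by auto
  have g'K: "g' y b = K b (g y)" if "y \<in> V" "b \<in> Basis" for y b
    using inv_f_f[OF bij_is_inj[OF bij[OF that(1)]], of "K b (g y)"]
    by (simp add: g'[OF that(1)] f'K[OF gV[OF that(1)] that(2)])
  have "smooth_map_on V g"
    using smooth_inverse_map[where g=g and g'=g' and K=K, OF V(1) M(1) gV g g'K KM] .
  then have "smooth_map_near g (\<Phi> z0)" "smooth_map_near \<Phi> z0"
    using V M \<Phi> by (auto simp: smooth_map_near_def)
  moreover have "\<forall>\<^sub>F x in nhds z0. x \<in> U" "\<forall>\<^sub>F y in nhds (\<Phi> z0). y \<in> V"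
    using U V by (simp_all add: eventually_nhds_in_open)
  then have "\<forall>\<^sub>F x in nhds z0. g (\<Phi> x) = x" "\<forall>\<^sub>F y in nhds (\<Phi> z0). \<Phi> (g y) = y"
    using homeomorphism_apply1[OF hom] homeomorphism_apply2[OF hom]
    by (auto elim: eventually_mono)
  ultimately have "local_diffeo \<Phi> g z0 (\<Phi> z0)"
    using homeomorphism_apply1[OF hom U(3)] unfolding local_diffeo_def by simp
  then show thesis
    by (rule that)
qed

text \<open>Near \<open>z\<close>, \<open>\<Phi>\<close> maps the lines spanned by the vector field \<open>\<xi>\<close> to the lines spanned by \<open>\<eta>\<close>. Nothing is
  required of the factor \<open>c\<close> besides being nonzero.\<close>

definition carries ::
    "('a::euclidean_space \<Rightarrow> 'a) \<Rightarrow> 'a \<Rightarrow> ('a \<Rightarrow> 'a) \<Rightarrow> ('a \<Rightarrow> 'a) \<Rightarrow> bool" where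
  "carries \<Phi> z \<xi> \<eta> \<longleftrightarrow>
    (\<forall>\<^sub>F x in nhds z. \<exists>c. c \<noteq> 0 \<and> frechet_derivative \<Phi> (at x) (\<xi> x) = c *\<^sub>R \<eta> (\<Phi> x))"

lemma carries_inverse:
  assumes L: "local_diffeo \<Phi> \<Xi> z w" and c: "carries \<Phi> z \<xi> \<eta>"
  shows "carries \<Xi> w \<eta> \<xi>"
proof -
  have lim: "filterlim \<Xi> (nhds z) (nhds w)"
    by (rule local_diffeo_filterlim[OF local_diffeo_sym[OF L]])
  have "\<forall>\<^sub>F x in nhds z. \<Phi> differentiable at x \<and> \<Xi> differentiable at (\<Phi> x) \<and>
      (\<forall>\<^sub>F x' in nhds x. \<Xi> (\<Phi> x') = x') \<and>
      (\<exists>c. c \<noteq> 0 \<and> frechet_derivative \<Phi> (at x) (\<xi> x) = c *\<^sub>R \<eta> (\<Phi> x))"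
  proof (intro eventually_conj)
    show "\<forall>\<^sub>F x in nhds z. \<Phi> differentiable at x"
      using L unfolding local_diffeo_def by (blast intro: smooth_map_near_eventually_differentiable)
    show "\<forall>\<^sub>F x in nhds z. \<Xi> differentiable at (\<Phi> x)"
      by (rule eventually_compose_filterlim[OF smooth_map_near_eventually_differentiable
            local_diffeo_filterlim[OF L]])
        (use L in \<open>simp add: local_diffeo_def\<close>)
    show "\<forall>\<^sub>F x in nhds z. \<forall>\<^sub>F x' in nhds x. \<Xi> (\<Phi> x') = x'"
      using L by (simp add: local_diffeo_def eventually_eventually)
    show "\<forall>\<^sub>F x in nhds z. \<exists>c. c \<noteq> 0 \<and> frechet_derivative \<Phi> (at x) (\<xi> x) = c *\<^sub>R \<eta> (\<Phi> x)"
      using c by (simp add: carries_def)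
  qed
  then have "\<forall>\<^sub>F x in nhds z. \<exists>c. c \<noteq> 0 \<and> frechet_derivative \<Xi> (at (\<Phi> x)) (\<eta> (\<Phi> x)) = c *\<^sub>R \<xi> x"
  proof (rule eventually_mono)
    fix x
    assume *: "\<Phi> differentiable at x \<and> \<Xi> differentiable at (\<Phi> x) \<and>
      (\<forall>\<^sub>F x' in nhds x. \<Xi> (\<Phi> x') = x') \<and>
      (\<exists>c. c \<noteq> 0 \<and> frechet_derivative \<Phi> (at x) (\<xi> x) = c *\<^sub>R \<eta> (\<Phi> x))"
    then obtain c where c: "c \<noteq> 0" "frechet_derivative \<Phi> (at x) (\<xi> x) = c *\<^sub>R \<eta> (\<Phi> x)"
      by blast
    obtain T where T: "open T" "x \<in> T" "\<And>x'. x' \<in> T \<Longrightarrow> \<Xi> (\<Phi> x') = x'"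
      using * unfolding eventually_nhds by blast
    have "((\<lambda>x. \<Xi> (\<Phi> x)) has_derivative
        (\<lambda>v. frechet_derivative \<Xi> (at (\<Phi> x)) (frechet_derivative \<Phi> (at x) v))) (at x)"
      using * diff_chain_at[of \<Phi> _ x \<Xi>] by (simp add: frechet_derivative_works o_def)
    moreover have "((\<lambda>x. \<Xi> (\<Phi> x)) has_derivative (\<lambda>v. v)) (at x)"
      by (rule has_derivative_transform_within_open[OF has_derivative_ident T(1,2)]) (simp add: T(3))
    ultimately have "(\<lambda>v. frechet_derivative \<Xi> (at (\<Phi> x)) (frechet_derivative \<Phi> (at x) v)) = (\<lambda>v. v)"
      by (rule has_derivative_unique)
    from fun_cong[OF this, of "\<xi> x"] c(2)
    have "frechet_derivative \<Xi> (at (\<Phi> x)) (c *\<^sub>R \<eta> (\<Phi> x)) = \<xi> x"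
      by simp
    moreover have "linear (frechet_derivative \<Xi> (at (\<Phi> x)))"
      using * by (simp add: linear_frechet_derivative)
    ultimately have "\<xi> x = c *\<^sub>R frechet_derivative \<Xi> (at (\<Phi> x)) (\<eta> (\<Phi> x))"
      by (simp add: linear_scale)
    then have "frechet_derivative \<Xi> (at (\<Phi> x)) (\<eta> (\<Phi> x)) = inverse c *\<^sub>R \<xi> x"
      using c(1) by simp
    then show "\<exists>c. c \<noteq> 0 \<and> frechet_derivative \<Xi> (at (\<Phi> x)) (\<eta> (\<Phi> x)) = c *\<^sub>R \<xi> x"
      using c(1) by (intro exI[of _ "inverse c"]) simp
  qed
  from eventually_compose_filterlim[OF this lim]
  have "\<forall>\<^sub>F y in nhds w. \<exists>c. c \<noteq> 0 \<and>
      frechet_derivative \<Xi> (at (\<Phi> (\<Xi> y))) (\<eta> (\<Phi> (\<Xi> y))) = c *\<^sub>R \<xi> (\<Xi> y)" .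
  moreover have "\<forall>\<^sub>F y in nhds w. \<Phi> (\<Xi> y) = y"
    using L by (simp add: local_diffeo_def)
  ultimately show ?thesis
    unfolding carries_def by eventually_elim simp
qed

lemma carries_compose:
  assumes L: "local_diffeo \<Phi> \<Xi> z w" and L': "local_diffeo \<Psi> \<Theta> w v"
    and c: "carries \<Phi> z \<xi> \<eta>" and c': "carries \<Psi> w \<eta> \<zeta>"
  shows "carries (\<lambda>x. \<Psi> (\<Phi> x)) z \<xi> \<zeta>"
proof -
  note lim = local_diffeo_filterlim[OF L]
  have "\<forall>\<^sub>F x in nhds z. \<Phi> differentiable at x"
    using L unfolding local_diffeo_def by (blast intro: smooth_map_near_eventually_differentiable)
  moreover have "\<forall>\<^sub>F x in nhds z. \<Psi> differentiable at (\<Phi> x)"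
    by (rule eventually_compose_filterlim[OF smooth_map_near_eventually_differentiable lim])
      (use L' in \<open>simp add: local_diffeo_def\<close>)
  moreover note c[unfolded carries_def] eventually_compose_filterlim[OF c'[unfolded carries_def] lim]
  ultimately show ?thesis
    unfolding carries_def
  proof eventually_elim
    case (elim x)
    then obtain a b where ab: "a \<noteq> 0" "b \<noteq> 0"
      "frechet_derivative \<Phi> (at x) (\<xi> x) = a *\<^sub>R \<eta> (\<Phi> x)"
      "frechet_derivative \<Psi> (at (\<Phi> x)) (\<eta> (\<Phi> x)) = b *\<^sub>R \<zeta> (\<Psi> (\<Phi> x))"
      by blast
    have "frechet_derivative (\<lambda>x. \<Psi> (\<Phi> x)) (at x)
        = (\<lambda>v. frechet_derivative \<Psi> (at (\<Phi> x)) (frechet_derivative \<Phi> (at x) v))"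
      using frechet_derivative_compose[of \<Phi> x \<Psi>] elim(1,2) by (simp add: o_def)
    moreover have "linear (frechet_derivative \<Psi> (at (\<Phi> x)))"
      using elim(2) by (simp add: linear_frechet_derivative)
    ultimately have "frechet_derivative (\<lambda>x. \<Psi> (\<Phi> x)) (at x) (\<xi> x) = (a * b) *\<^sub>R \<zeta> (\<Psi> (\<Phi> x))"
      by (simp add: ab linear_scale)
    with ab(1,2) show ?case
      by (intro exI[of _ "a * b"]) simp
  qed
qed

text \<open>A local diffeomorphism at \<open>z\<close> with value \<open>w\<close> carries the pair of line fields spanned by \<open>\<xi>1\<close>, \<open>\<xi>2\<close> to
  the pair spanned by \<open>\<eta>1\<close>, \<open>\<eta>2\<close>, in this order.\<close>

definition line_pair_equiv ::
    "'a::euclidean_space \<Rightarrow> ('a \<Rightarrow> 'a) \<Rightarrow> ('a \<Rightarrow> 'a) \<Rightarrow> 'a \<Rightarrow> ('a \<Rightarrow> 'a) \<Rightarrow> ('a \<Rightarrow> 'a) \<Rightarrow> bool" where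
  "line_pair_equiv z \<xi>1 \<xi>2 w \<eta>1 \<eta>2 \<longleftrightarrow>
    (\<exists>\<Phi> \<Xi>. local_diffeo \<Phi> \<Xi> z w \<and> carries \<Phi> z \<xi>1 \<eta>1 \<and> carries \<Phi> z \<xi>2 \<eta>2)"

lemma line_pair_equiv_sym: "line_pair_equiv z \<xi>1 \<xi>2 w \<eta>1 \<eta>2 \<Longrightarrow> line_pair_equiv w \<eta>1 \<eta>2 z \<xi>1 \<xi>2"
  unfolding line_pair_equiv_def by (meson carries_inverse local_diffeo_sym)

lemma line_pair_equiv_swap: "line_pair_equiv z \<xi>1 \<xi>2 w \<eta>1 \<eta>2 \<Longrightarrow> line_pair_equiv z \<xi>2 \<xi>1 w \<eta>2 \<eta>1"
  unfolding line_pair_equiv_def by blast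

lemma line_pair_equiv_trans:
  "line_pair_equiv z \<xi>1 \<xi>2 w \<eta>1 \<eta>2 \<Longrightarrow> line_pair_equiv w \<eta>1 \<eta>2 v \<zeta>1 \<zeta>2 \<Longrightarrow> line_pair_equiv z \<xi>1 \<xi>2 v \<zeta>1 \<zeta>2"
  unfolding line_pair_equiv_def using carries_compose local_diffeo_trans by (elim exE conjE) blast

section \<open>The frame in coordinates\<close>

lemma Basis_triple: "(Basis :: (real \<times> real \<times> real) set) = {(1, 0, 0), (0, 1, 0), (0, 0, 1)}"
  by (auto simp: Basis_prod_def zero_prod_def)

lemma triple_basis [simp]:
  "(1, 0, 0) \<in> (Basis :: (real \<times> real \<times> real) set)"
  "(0, 1, 0) \<in> (Basis :: (real \<times> real \<times> real) set)"
  "(0, 0, 1) \<in> (Basis :: (real \<times> real \<times> real) set)"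
  by (simp_all add: Basis_triple)

lemma sum_Basis_triple: "(\<Sum>b\<in>(Basis :: (real \<times> real \<times> real) set). g b) = g (1, 0, 0) + g (0, 1, 0) + g (0, 0, 1)"
  for g :: "_ \<Rightarrow> 'a::real_vector"
  by (simp add: Basis_triple add.assoc)

lemma smooth_on_third: "open M \<Longrightarrow> smooth_on M (\<lambda>z :: real \<times> real \<times> real. snd (snd z))"
  using smooth_on_inner[of M "(0, 0, 1)"] by (simp add: inner_prod_def)

lemma partial_third:
  "d1 (\<lambda>z. snd (snd z)) z = 0" "d2 (\<lambda>z. snd (snd z)) z = 0" "d3 (\<lambda>z. snd (snd z)) z = 1"
  by (subst partial_eq[of _ "\<lambda>v. snd (snd v)"]; auto intro!: derivative_eq_intros)+

lemma smooth_on_has_derivative_triple: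
  assumes "open M" "smooth_on M f" "z \<in> M"
  shows "(f has_derivative (\<lambda>(a, b, c). a * d1 f z + b * d2 f z + c * d3 f z)) (at z)"
  using smooth_on_has_derivative[OF assms] by (simp add: sum_Basis_triple inner_prod_def split_beta')

lemma total_D_eq: "total_D Q g z = d1 g z + snd (snd z) * d2 g z + Q z * d3 g z"
  by (cases z) (simp add: total_D_def)

lemma function_ring_smooth_on: "open M \<Longrightarrow> function_ring (smooth_on M)"
  by unfold_locales (auto simp: smooth_on_const smooth_on_add smooth_on_mult)

lemma derivation_partial:
  assumes "open M" "b \<in> Basis"
  shows "derivation M (smooth_on M) (partial b)"
proof -
  interpret function_ring "smooth_on M"
    by (rule function_ring_smooth_on[OF assms(1)])
  note d = smooth_on_has_derivative[OF assms(1)]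
  show ?thesis
  proof
    fix f g :: "'a \<Rightarrow> real" and z assume f: "smooth_on M f" "smooth_on M g" and z: "z \<in> M"
    show "partial b (\<lambda>w. f w + g w) z = partial b f z + partial b g z"
      by (rule trans[OF partial_eq[OF has_derivative_add[OF d[OF f(1) z] d[OF f(2) z]]]])
        (simp add: sum_Basis_partial[OF assms(2)])
    show "partial b (\<lambda>w. f w * g w) z = partial b f z * g z + f z * partial b g z"
      by (rule trans[OF partial_eq[OF has_derivative_mult[OF d[OF f(1) z] d[OF f(2) z]]]])
        (simp add: sum_Basis_partial[OF assms(2)])
  next
    show "partial b f z = partial b g z" if "\<And>w. w \<in> M \<Longrightarrow> f w = g w" "z \<in> M" for f g z
      by (rule partial_cong_open[OF assms(1) that(2,1)])
    show "partial b (\<lambda>_. c) z = 0" for c z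
      by (rule partial_eq[OF has_derivative_const])
  qed (rule smooth_on_partial[OF _ assms(2)])
qed

lemma derivation_combination:
  assumes "derivation M S X" "derivation M S Y" "S f"
  shows "derivation M S (\<lambda>g z. X g z + f z * Y g z)"
proof -
  interpret X: derivation M S X by fact
  interpret Y: derivation M S Y by fact
  note [simp] = assms(3)
  show ?thesis
  proof
    show "X f' z + f z * Y f' z = X g z + f z * Y g z"
      if "S f'" "S g" "\<And>w. w \<in> M \<Longrightarrow> f' w = g w" "z \<in> M" for f' g z
      using X.cong[OF that] Y.cong[OF that] by simp
  qed (simp_all add: algebra_simps)
qed

text \<open>The commutator of \<open>\<partial>\<^sub>p\<close> and the total derivative, \<open>\<partial>\<^sub>y + Q\<^sub>p \<partial>\<^sub>p\<close>.\<close>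

definition d_U :: "(real \<times> real \<times> real \<Rightarrow> real) \<Rightarrow> (real \<times> real \<times> real \<Rightarrow> real) \<Rightarrow> real \<times> real \<times> real \<Rightarrow> real" where
  "d_U Q g z = d2 g z + d3 Q z * d3 g z"

lemma ode_frame:
  assumes M: "open M" and Q [simp]: "smooth_on M Q"
  shows "ode_frame M (smooth_on M) d3 (total_D Q) (d_U Q)
    (d3 (d3 Q)) (\<lambda>z. total_D Q (d3 Q) z - d2 Q z) (d3 Q)"
proof -
  interpret E1: derivation M "smooth_on M" d1 by (rule derivation_partial[OF M]) simp
  interpret E2: derivation M "smooth_on M" d2 by (rule derivation_partial[OF M]) simp
  interpret E3: derivation M "smooth_on M" d3 by (rule derivation_partial[OF M]) simp
  note [simp] = smooth_on_third[OF M]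
  interpret D: derivation M "smooth_on M" "total_D Q"
    unfolding total_D_eq[abs_def]
    by (intro derivation_combination E1.derivation_axioms E2.derivation_axioms E3.derivation_axioms) simp_all
  interpret U: derivation M "smooth_on M" "d_U Q"
    unfolding d_U_def[abs_def]
    by (intro derivation_combination E2.derivation_axioms E3.derivation_axioms) simp
  have c: "d2 (d1 f) z = d1 (d2 f) z" "d3 (d1 f) z = d1 (d3 f) z" "d3 (d2 f) z = d2 (d3 f) z"
    if "smooth_on M f" "z \<in> M" for f z
    by (rule partial_commute[OF M that(1) _ _ that(2)]; simp)+
  have D_fun: "total_D Q f = (\<lambda>z. d1 f z + snd (snd z) * d2 f z + Q z * d3 f z)"
    and U_fun: "d_U Q f = (\<lambda>z. d2 f z + d3 Q z * d3 f z)" for f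
    by (simp_all add: total_D_eq[abs_def] d_U_def[abs_def])
  show ?thesis
  proof
    fix z assume z: "z \<in> M"
    have "d3 (total_D Q (d3 Q)) z = total_D Q (d3 (d3 Q)) z + d_U Q (d3 Q) z"
      unfolding D_fun[of "d3 Q"] using z by (simp add: total_D_eq d_U_def c partial_third)
    moreover have "d3 (\<lambda>z. total_D Q (d3 Q) z - d2 Q z) z = d3 (total_D Q (d3 Q)) z - d3 (d2 Q) z"
      using z by simp
    ultimately show "d3 (\<lambda>z. total_D Q (d3 Q) z - d2 Q z) z = total_D Q (d3 (d3 Q)) z + d3 Q z * d3 (d3 Q) z"
      using z by (simp add: d_U_def c)
  next
    fix f z assume f [simp]: "smooth_on M f" and z: "z \<in> M"
    show "d3 (total_D Q f) z = total_D Q (d3 f) z + d_U Q f z"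
      unfolding D_fun[of f] using z by (simp add: total_D_eq d_U_def c partial_third)
    show "d3 (d_U Q f) z = d_U Q (d3 f) z + d3 (d3 Q) z * d3 f z"
      unfolding U_fun[of f] using z by (simp add: d_U_def c)
    show "d_U Q (total_D Q f) z = total_D Q (d_U Q f) z - (total_D Q (d3 Q) z - d2 Q z) * d3 f z
        + d3 Q z * d_U Q f z"
      unfolding D_fun[of f] U_fun[of f]
      using z by (simp add: total_D_eq d_U_def c partial_third algebra_simps)
  qed simp_all
qed

lemma w1_eq_curvature:
  assumes M: "open M" and Q [simp]: "smooth_on M Q" and z: "z \<in> M"
  shows "w1 Q z = ode_frame.curvature (total_D Q) (d_U Q)
    (d3 (d3 Q)) (\<lambda>z. total_D Q (d3 Q) z - d2 Q z) (d3 Q) z"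
proof -
  interpret ode_frame M "smooth_on M" d3 "total_D Q" "d_U Q"
    "d3 (d3 Q)" "\<lambda>z. total_D Q (d3 Q) z - d2 Q z" "d3 Q"
    by (rule ode_frame[OF M Q])
  interpret E2: derivation M "smooth_on M" d2 by (rule derivation_partial[OF M]) simp
  have d2r: "d2 (d3 Q) z = d_U Q (d3 Q) z - d3 Q z * d3 (d3 Q) z" for z
    by (simp add: d_U_def)
  have Dr: "total_D Q (d2 (d3 Q)) z
      = total_D Q (\<lambda>z. d_U Q (d3 Q) z - d3 Q z * d3 (d3 Q) z) z"
    by (rule D.cong) (use z in \<open>simp_all add: d2r\<close>)
  have "d3 (d2 Q) z = d2 (d3 Q) z"
    by (rule partial_commute[OF M Q _ _ z]) simp_all
  then have d22: "d2 (d2 Q) z = d_U Q (d2 Q) z - d3 Q z * d2 (d3 Q) z"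
    by (simp add: d_U_def)
  have "d_U Q (\<lambda>z. total_D Q (d3 Q) z - d2 Q z) z = d_U Q (total_D Q (d3 Q)) z - d_U Q (d2 Q) z"
    using z by simp
  then show ?thesis
    unfolding w1_def curvature_def d22 d2r Dr using z
    by (simp add: UD algebra_simps power2_eq_square)
qed

section \<open>Exchanging the two line fields\<close>

lemma smooth_map_on_triple:
  "smooth_map_on M (\<lambda>z. (A z, B z, C z)) \<longleftrightarrow> smooth_on M A \<and> smooth_on M B \<and> smooth_on M C"
  for A B C :: "_ \<Rightarrow> real"
  by (simp add: smooth_map_on_def Basis_triple)

lemma smooth_map_on_components:
  fixes \<Phi> :: "'a::euclidean_space \<Rightarrow> real \<times> real \<times> real"
  shows "smooth_map_on M \<Phi> \<longleftrightarrow>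
    smooth_on M (\<lambda>z. fst (\<Phi> z)) \<and> smooth_on M (\<lambda>z. fst (snd (\<Phi> z))) \<and> smooth_on M (\<lambda>z. snd (snd (\<Phi> z)))"
  using smooth_map_on_triple[of M "\<lambda>z. fst (\<Phi> z)" "\<lambda>z. fst (snd (\<Phi> z))" "\<lambda>z. snd (snd (\<Phi> z))"] by simp

lemma frechet_derivative_triple:
  fixes A B C :: "real \<times> real \<times> real \<Rightarrow> real"
  assumes "open M" "smooth_on M A" "smooth_on M B" "smooth_on M C" "z \<in> M"
  shows "frechet_derivative (\<lambda>z. (A z, B z, C z)) (at z) (a, b, c) =
    (a * d1 A z + b * d2 A z + c * d3 A z, a * d1 B z + b * d2 B z + c * d3 B z,
     a * d1 C z + b * d2 C z + c * d3 C z)"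
proof -
  note d = smooth_on_has_derivative_triple[OF assms(1) _ assms(5)]
  show ?thesis
    using frechet_derivative_at[OF has_derivative_Pair[OF d[OF assms(2)]
        has_derivative_Pair[OF d[OF assms(3)] d[OF assms(4)]]], symmetric] by simp
qed

text \<open>The Jacobian determinant of \<open>(A, B, C)\<close>, expanded along the first row.\<close>

definition jacobian ::
    "(real \<times> real \<times> real \<Rightarrow> real) \<Rightarrow> (real \<times> real \<times> real \<Rightarrow> real) \<Rightarrow> (real \<times> real \<times> real \<Rightarrow> real) \<Rightarrow>
     real \<times> real \<times> real \<Rightarrow> real" where
  "jacobian A B C z =
     d1 A z * (d2 B z * d3 C z - d3 B z * d2 C z) - d2 A z * (d1 B z * d3 C z - d3 B z * d1 C z)
     + d3 A z * (d1 B z * d2 C z - d2 B z * d1 C z)"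

lemma local_diffeo_triple:
  fixes A B C :: "real \<times> real \<times> real \<Rightarrow> real"
  assumes "smooth_near A z0" "smooth_near B z0" "smooth_near C z0" and J0: "jacobian A B C z0 \<noteq> 0"
  obtains \<Xi> where "local_diffeo (\<lambda>z. (A z, B z, C z)) \<Xi> z0 (A z0, B z0, C z0)"
proof -
  obtain MA MB MC where "open MA" "z0 \<in> MA" "smooth_on MA A" "open MB" "z0 \<in> MB" "smooth_on MB B"
    "open MC" "z0 \<in> MC" "smooth_on MC C"
    using assms(1-3) unfolding smooth_near_iff by blast
  then have N: "open (MA \<inter> MB \<inter> MC)" "z0 \<in> MA \<inter> MB \<inter> MC" "smooth_on (MA \<inter> MB \<inter> MC) A"
    "smooth_on (MA \<inter> MB \<inter> MC) B" "smooth_on (MA \<inter> MB \<inter> MC) C"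
    by (auto intro: smooth_on_subset)
  define N where "N = MA \<inter> MB \<inter> MC"
  note N = N[folded N_def]
  note sm = smooth_on_add[OF N(1)] smooth_on_diff[OF N(1)] smooth_on_mult[OF N(1)]
    smooth_on_partial[OF N(3)] smooth_on_partial[OF N(4)] smooth_on_partial[OF N(5)]
  have J: "smooth_on N (jacobian A B C)"
    unfolding jacobian_def[abs_def] by (simp add: sm)
  define M where "M = {z \<in> N. jacobian A B C z \<in> - {0}}"
  have M: "open M" "z0 \<in> M"
    using open_vimage_Int[OF N(1) smooth_on_continuous[OF J], of "- {0}"] N(2) J0
    by (auto simp: M_def)
  have MN: "M \<subseteq> N"
    by (auto simp: M_def)
  note MS = smooth_on_subset[OF _ MN]
  have nz: "jacobian A B C z \<noteq> 0" if "z \<in> M" for z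
    using that by (simp add: M_def)
  note sm' = smooth_on_divide[OF M(1)] smooth_on_const[OF M(1)] smooth_on_add[OF M(1)]
    smooth_on_diff[OF M(1)] smooth_on_mult[OF M(1)] smooth_on_partial[OF N(3)[THEN MS]]
    smooth_on_partial[OF N(4)[THEN MS]] smooth_on_partial[OF N(5)[THEN MS]] J[THEN MS] nz
  \<comment> \<open>the inverse of the Jacobian matrix, by Cramer's rule, applied to \<open>b\<close>\<close>
  define K :: "real \<times> real \<times> real \<Rightarrow> real \<times> real \<times> real \<Rightarrow> real \<times> real \<times> real" where
    "K = (\<lambda>b z.
     ((fst b * (d2 B z * d3 C z - d3 B z * d2 C z) + fst (snd b) * (d2 C z * d3 A z - d3 C z * d2 A z)
       + snd (snd b) * (d2 A z * d3 B z - d3 A z * d2 B z)) / jacobian A B C z,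
      (fst b * (d3 B z * d1 C z - d1 B z * d3 C z) + fst (snd b) * (d3 C z * d1 A z - d1 C z * d3 A z)
       + snd (snd b) * (d3 A z * d1 B z - d1 A z * d3 B z)) / jacobian A B C z,
      (fst b * (d1 B z * d2 C z - d2 B z * d1 C z) + fst (snd b) * (d1 C z * d2 A z - d2 C z * d1 A z)
       + snd (snd b) * (d1 A z * d2 B z - d2 A z * d1 B z)) / jacobian A B C z))"
  have "frechet_derivative (\<lambda>z. (A z, B z, C z)) (at z) (K b z) = b" if z: "z \<in> M" for z b
  proof -
    have *: "u / j * p + v / j * q + w / j * r = t"
      if "j \<noteq> 0" "u * p + v * q + w * r = t * j" for p q r u v w t j :: real
      using that by (simp add: field_simps)
    show ?thesis
      unfolding K_def frechet_derivative_triple[OF N(1,3,4,5) subsetD[OF MN z]]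
      by (simp only: prod_eq_iff fst_conv snd_conv, intro conjI; rule *[OF nz[OF z]])
        (simp_all add: jacobian_def algebra_simps)
  qed
  moreover have "smooth_map_on M (K b)" for b
    unfolding K_def smooth_map_on_triple by (simp add: sm')
  ultimately show thesis
    using smooth_inverse_function[OF M, of "\<lambda>z. (A z, B z, C z)" K] N(3,4,5)[THEN MS] that
    unfolding smooth_map_on_triple by blast
qed

text \<open>The two line fields of \<open>y'' = Q (x, y, y')\<close> on the space of \<open>(x, y, p)\<close>: the fibres of the projection
  to \<open>(x, y)\<close>, and the solution curves.\<close>

definition V_field :: "real \<times> real \<times> real \<Rightarrow> real \<times> real \<times> real" where
  "V_field z = (0, 0, 1)"

definition D_field :: "(real \<times> real \<times> real \<Rightarrow> real) \<Rightarrow> real \<times> real \<times> real \<Rightarrow> real \<times> real \<times> real" where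
  "D_field Q z = (1, snd (snd z), Q z)"

lemma frechet_derivative_D_field:
  assumes "open M" "smooth_on M f" "z \<in> M"
  shows "frechet_derivative f (at z) (D_field Q z) = total_D Q f z"
  using frechet_derivative_at[OF smooth_on_has_derivative_triple[OF assms], symmetric]
  by (simp add: D_field_def total_D_eq)

text \<open>A local equivalence that exchanges the two line fields turns \<open>w1\<close> of the first equation into \<open>w2\<close>
  of the second one, up to a nowhere vanishing factor.\<close>

lemma w2_dual_multiple_of_w1:
  assumes "line_pair_equiv z0 V_field (D_field Q) w0 (D_field q) V_field"
    and "smooth_near Q z0" "smooth_near q w0"
  obtains \<Phi> \<Xi> where "local_diffeo \<Phi> \<Xi> z0 w0"
    "\<forall>\<^sub>F z in nhds z0. \<exists>c. c \<noteq> 0 \<and> w2 q (\<Phi> z) = c * w1 Q z"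
proof -
  obtain \<Phi> \<Xi> where L: "local_diffeo \<Phi> \<Xi> z0 w0" and cV: "carries \<Phi> z0 V_field (D_field q)"
    and cD: "carries \<Phi> z0 (D_field Q) V_field"
    using assms(1) unfolding line_pair_equiv_def by blast
  obtain M1 where M1: "open M1" "z0 \<in> M1" "smooth_map_on M1 \<Phi>"
    using L unfolding local_diffeo_def smooth_map_near_def by blast
  obtain M2 where M2: "open M2" "z0 \<in> M2" "\<And>z. z \<in> M2 \<Longrightarrow>
      \<exists>c. c \<noteq> 0 \<and> frechet_derivative \<Phi> (at z) (V_field z) = c *\<^sub>R D_field q (\<Phi> z)"
    using cV unfolding carries_def eventually_nhds by blast
  obtain M3 where M3: "open M3" "z0 \<in> M3" "\<And>z. z \<in> M3 \<Longrightarrow>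
      \<exists>c. c \<noteq> 0 \<and> frechet_derivative \<Phi> (at z) (D_field Q z) = c *\<^sub>R V_field (\<Phi> z)"
    using cD unfolding carries_def eventually_nhds by blast
  obtain M4 where M4: "open M4" "z0 \<in> M4" "smooth_on M4 Q"
    using assms(2) unfolding smooth_near_iff by blast
  obtain N where N: "open N" "w0 \<in> N" "smooth_on N q"
    using assms(3) unfolding smooth_near_iff by blast
  have oN: "open {z \<in> M1. \<Phi> z \<in> N}"
    by (rule open_vimage_Int[OF M1(1) smooth_map_on_continuous[OF M1(1,3)] N(1)])
  define M where "M = {z \<in> M1. \<Phi> z \<in> N} \<inter> M2 \<inter> M3 \<inter> M4"
  have M: "open M" "z0 \<in> M"
    using oN M1 M2 M3 M4 N L by (auto simp: M_def local_diffeo_def)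
  have \<Phi>: "smooth_map_on M \<Phi>"
    by (rule smooth_map_on_subset[OF M1(3)]) (auto simp: M_def)
  have Q [simp]: "smooth_on M Q"
    by (rule smooth_on_subset[OF M4(3)]) (auto simp: M_def)
  have \<Phi>N: "\<Phi> z \<in> N" if "z \<in> M" for z
    using that by (auto simp: M_def)
  interpret ode_frame M "smooth_on M" d3 "total_D Q" "d_U Q"
    "d3 (d3 Q)" "\<lambda>z. total_D Q (d3 Q) z - d2 Q z" "d3 Q"
    by (rule ode_frame[OF M(1) Q])
  define X where "X = (\<lambda>z. fst (\<Phi> z))"
  define Y where "Y = (\<lambda>z. fst (snd (\<Phi> z)))"
  define P where "P = (\<lambda>z. snd (snd (\<Phi> z)))"
  have XYP [simp]: "smooth_on M X" "smooth_on M Y" "smooth_on M P"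
    using \<Phi> unfolding smooth_map_on_components X_def Y_def P_def by simp_all
  have \<Phi>_eq: "\<Phi> = (\<lambda>z. (X z, Y z, P z))"
    by (simp add: X_def Y_def P_def)
  note fd = frechet_derivative_triple[OF M(1) XYP]
  have V: "d3 X z \<noteq> 0 \<and> d3 Y z = P z * d3 X z \<and> d3 P z = q (\<Phi> z) * d3 X z" if z: "z \<in> M" for z
    using M2(3)[of z] z fd[OF z, of 0 0 1] by (auto simp: M_def V_field_def D_field_def \<Phi>_eq)
  have D: "total_D Q P z \<noteq> 0 \<and> total_D Q X z = 0 \<and> total_D Q Y z = 0" if z: "z \<in> M" for z
    using M3(3)[of z] z fd[OF z, of 1 "snd (snd z)" "Q z"]
    by (auto simp: M_def V_field_def D_field_def total_D_eq \<Phi>_eq)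
  have q [simp]: "smooth_on M (\<lambda>z. q (\<Phi> z))"
    by (rule smooth_map_on_compose_fun[OF M(1) N(1) \<Phi> \<Phi>N N(3)])
  define s where "s = d3 X"
  define e where "e = total_D Q P"
  have es [simp]: "smooth_on M e" "smooth_on M s"
    by (simp_all add: e_def s_def)
  have nz: "e z \<noteq> 0" "s z \<noteq> 0" if "z \<in> M" for z
    using V[OF that] D[OF that] by (simp_all add: e_def s_def)
  obtain l where l [simp]: "smooth_on M l"
    and l_eq: "\<And>z b. z \<in> M \<Longrightarrow> b \<in> Basis \<Longrightarrow> partial b e z = e z * partial b l z"
    using smooth_on_logarithm[OF M(1) nz(1) es(1)] by blast
  obtain t where t [simp]: "smooth_on M t"
    and t_eq: "\<And>z b. z \<in> M \<Longrightarrow> b \<in> Basis \<Longrightarrow> partial b s z = s z * partial b t z"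
    using smooth_on_logarithm[OF M(1) nz(2) es(2)] by blast
  define i where "i = (\<lambda>z. inverse (e z))"
  define j where "j = (\<lambda>z. inverse (s z))"
  have ij [simp]: "smooth_on M i" "smooth_on M j"
    unfolding i_def j_def using nz by (simp_all add: smooth_on_inverse[OF M(1)])
  define W where "W = (\<lambda>f z. i z * total_D Q f z)"
  have le: "d3 e z = e z * d3 l z" "total_D Q e z = e z * total_D Q l z" if "z \<in> M" for z
    using l_eq[OF that] by (simp_all add: total_D_eq algebra_simps)
  have te: "d3 s z = s z * d3 t z" "total_D Q s z = s z * total_D Q t z" "d_U Q s z = s z * d_U Q t z"
    if "z \<in> M" for z
    using t_eq[OF that] by (simp_all add: total_D_eq d_U_def algebra_simps)
  have inv: "i z * e z = 1" "j z * s z = 1" if "z \<in> M" for z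
    using nz[OF that] by (simp_all add: i_def j_def)
  have XD: "total_D Q X z = 0" "d3 X z = s z" "total_D Q Y z = 0" "d3 Y z = P z * s z"
    "total_D Q P z = e z" "d3 P z = q (\<Phi> z) * s z" if "z \<in> M" for z
    using V[OF that] D[OF that] by (simp_all add: e_def s_def)
  have main: "W (W (W (W (\<lambda>z. q (\<Phi> z))))) z = i z * i z * i z * j z * curvature z" if z: "z \<in> M" for z
    unfolding W_def
    by (rule fourth_derivative_of_dual[where X=X and Y=Y and P=P and e=e and s=s and l=l and t=t and i=i and j=j
          and q="\<lambda>z. q (\<Phi> z)", OF XYP q l t ij es(2,1) XD le te inv z])
  \<comment> \<open>\<open>W\<close> corresponds to \<open>\<partial>\<^sub>P\<close> under \<open>\<Phi>\<close>\<close>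
  have W: "W f z = d3 g (\<Phi> z)"
    if "smooth_on N g" "\<And>z. z \<in> M \<Longrightarrow> f z = g (\<Phi> z)" "z \<in> M" for f g z
  proof -
    have g: "smooth_on M (\<lambda>z. g (\<Phi> z))"
      by (rule smooth_map_on_compose_fun[OF M(1) N(1) \<Phi> \<Phi>N that(1)])
    have "smooth_on M f"
      using g smooth_on_cong[OF M(1), of f "\<lambda>z. g (\<Phi> z)"] that(2) by simp
    then have "total_D Q f z = total_D Q (\<lambda>z. g (\<Phi> z)) z"
      using g that(2,3) by (rule D.cong)
    also have "\<dots> = frechet_derivative (\<lambda>z. g (\<Phi> z)) (at z) (D_field Q z)"
      by (rule frechet_derivative_D_field[OF M(1) g that(3), symmetric])
    also have "\<dots> = frechet_derivative g (at (\<Phi> z)) (frechet_derivative \<Phi> (at z) (D_field Q z))"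
    proof -
      have "g differentiable at (\<Phi> z)"
        using smooth_on_has_derivative[OF N(1) that(1) \<Phi>N[OF that(3)]] unfolding differentiable_def by blast
      then show ?thesis
        using frechet_derivative_compose[OF smooth_map_on_differentiable[OF M(1) \<Phi> that(3)], of g]
        by (simp add: o_def)
    qed
    also have "frechet_derivative \<Phi> (at z) (D_field Q z) = (0, 0, e z)"
      using fd[OF that(3), of 1 "snd (snd z)" "Q z"] D[OF that(3)]
      by (simp add: D_field_def e_def total_D_eq \<Phi>_eq)
    also have "frechet_derivative g (at (\<Phi> z)) (0, 0, e z) = e z * d3 g (\<Phi> z)"
      using frechet_derivative_at[OF smooth_on_has_derivative_triple[OF N(1) that(1) \<Phi>N[OF that(3)]], symmetric]
      by simp
    finally show ?thesis
      using nz[OF that(3)] by (simp add: W_def i_def)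
  qed
  have "w2 q (\<Phi> z) = i z * i z * i z * j z * w1 Q z" if z: "z \<in> M" for z
  proof -
    note sp = smooth_on_partial[OF _ triple_basis(3)]
    note q1 = sp[OF N(3)] and q2 = sp[OF sp[OF N(3)]] and q3 = sp[OF sp[OF sp[OF N(3)]]]
    have "W (W (W (W (\<lambda>z. q (\<Phi> z))))) z = d3 (d3 (d3 (d3 q))) (\<Phi> z)"
      by (rule W[OF q3 W[OF q2 W[OF q1 W[OF N(3) refl]]] z])
    then show ?thesis
      using main[OF z] by (simp add: w2_def w1_eq_curvature[OF M(1) Q z])
  qed
  moreover have "i z * i z * i z * j z \<noteq> 0" if "z \<in> M" for z
    using nz[OF that] by (simp add: i_def j_def)
  ultimately have "\<forall>\<^sub>F z in nhds z0. \<exists>c. c \<noteq> 0 \<and> w2 q (\<Phi> z) = c * w1 Q z"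
    using M unfolding eventually_nhds by blast
  with L show thesis
    by (rule that)
qed

lemma smooth_on_coordinates:
  assumes "open M"
  shows "smooth_on M (\<lambda>z :: real \<times> real \<times> real. fst z)" "smooth_on M (\<lambda>z :: real \<times> real \<times> real. fst (snd z))"
    "smooth_on M (\<lambda>z :: real \<times> real \<times> real. snd (snd z))"
  using smooth_on_inner[OF assms, of "(1, 0, 0)"] smooth_on_inner[OF assms, of "(0, 1, 0)"]
    smooth_on_third[OF assms] by (simp_all add: inner_prod_def)

lemma partial_coordinates:
  "partial (a, b, c) (\<lambda>z :: real \<times> real \<times> real. fst z) z = a"
  "partial (a, b, c) (\<lambda>z :: real \<times> real \<times> real. fst (snd z)) z = b"
  "partial (a, b, c) (\<lambda>z :: real \<times> real \<times> real. snd (snd z)) z = c"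
  by (rule trans[OF partial_eq[of _ "\<lambda>v. fst v"]], auto intro!: derivative_eq_intros,
      rule trans[OF partial_eq[of _ "\<lambda>v. fst (snd v)"]], auto intro!: derivative_eq_intros,
      rule trans[OF partial_eq[of _ "\<lambda>v. snd (snd v)"]], auto intro!: derivative_eq_intros)

lemma smooth_on_compose_triple:
  fixes g A B C :: "real \<times> real \<times> real \<Rightarrow> real"
  assumes M: "open M" and N: "open N" and S: "smooth_on M A" "smooth_on M B" "smooth_on M C"
    and g: "smooth_on N g" and MN: "\<And>z. z \<in> M \<Longrightarrow> (A z, B z, C z) \<in> N"
  shows "smooth_on M (\<lambda>z. g (A z, B z, C z))"
    and "z \<in> M \<Longrightarrow> b \<in> Basis \<Longrightarrow> partial b (\<lambda>z. g (A z, B z, C z)) z =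
      partial b A z * d1 g (A z, B z, C z) + partial b B z * d2 g (A z, B z, C z)
      + partial b C z * d3 g (A z, B z, C z)"
proof -
  show "smooth_on M (\<lambda>z. g (A z, B z, C z))"
    by (rule smooth_map_on_compose_fun[OF M N _ MN g]) (use S in \<open>simp add: smooth_map_on_triple\<close>)
  assume z: "z \<in> M" and b: "b \<in> Basis"
  note d = smooth_on_has_derivative[OF M _ z]
  have "((\<lambda>z. (A z, B z, C z)) has_derivative (\<lambda>v. (\<Sum>b\<in>Basis. (v \<bullet> b) * partial b A z,
      \<Sum>b\<in>Basis. (v \<bullet> b) * partial b B z, \<Sum>b\<in>Basis. (v \<bullet> b) * partial b C z))) (at z)"
    by (intro has_derivative_Pair d S)
  from diff_chain_at[OF this smooth_on_has_derivative_triple[OF N g MN[OF z]]]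
  have "((\<lambda>z. g (A z, B z, C z)) has_derivative
      (\<lambda>v. (\<Sum>b\<in>Basis. (v \<bullet> b) * partial b A z) * d1 g (A z, B z, C z)
        + (\<Sum>b\<in>Basis. (v \<bullet> b) * partial b B z) * d2 g (A z, B z, C z)
        + (\<Sum>b\<in>Basis. (v \<bullet> b) * partial b C z) * d3 g (A z, B z, C z))) (at z)"
    by (simp add: o_def)
  from partial_eq[OF this, of b]
  show "partial b (\<lambda>z. g (A z, B z, C z)) z =
      partial b A z * d1 g (A z, B z, C z) + partial b B z * d2 g (A z, B z, C z)
      + partial b C z * d3 g (A z, B z, C z)"
    by (simp only: sum_Basis_partial[OF b])
qed

section \<open>Point transformations\<close>

lemma Basis_pair: "(Basis :: (real \<times> real) set) = {(1, 0), (0, 1)}"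
  by (auto simp: Basis_prod_def)

text \<open>Functions of \<open>(x, y)\<close>, viewed as functions of \<open>(x, y, p)\<close>.\<close>

lemma smooth_on_lift_pair:
  fixes A :: "real \<times> real \<Rightarrow> real"
  assumes N: "open N" and A: "smooth_on N A"
  defines "M \<equiv> {z :: real \<times> real \<times> real. (fst z, fst (snd z)) \<in> N}"
  shows "open M" "smooth_on M (\<lambda>z. A (fst z, fst (snd z)))"
    and "z \<in> M \<Longrightarrow> d1 (\<lambda>z. A (fst z, fst (snd z))) z = partial (1, 0) A (fst z, fst (snd z))"
    and "z \<in> M \<Longrightarrow> d2 (\<lambda>z. A (fst z, fst (snd z))) z = partial (0, 1) A (fst z, fst (snd z))"
    and "z \<in> M \<Longrightarrow> d3 (\<lambda>z. A (fst z, fst (snd z))) z = 0"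
proof -
  show M: "open M"
    using open_vimage_Int[OF open_UNIV _ N, of "\<lambda>z :: real \<times> real \<times> real. (fst z, fst (snd z))"]
    by (simp add: M_def continuous_intros)
  have "smooth_map_on M (\<lambda>z. (fst z, fst (snd z)))"
    using smooth_on_coordinates[OF M] by (simp add: smooth_map_on_def Basis_pair)
  then show "smooth_on M (\<lambda>z. A (fst z, fst (snd z)))"
    by (rule smooth_map_on_compose_fun[OF M N]) (simp_all add: M_def A)
  assume z: "z \<in> M"
  then have dA: "(A has_derivative (\<lambda>v. fst v * partial (1, 0) A (fst z, fst (snd z))
      + snd v * partial (0, 1) A (fst z, fst (snd z)))) (at (fst z, fst (snd z)))"
    using smooth_on_has_derivative[OF N A, of "(fst z, fst (snd z))"]
    by (simp add: M_def Basis_pair inner_prod_def)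
  have "((\<lambda>z. (fst z, fst (snd z))) has_derivative (\<lambda>v. (fst v, fst (snd v)))) (at z)"
    by (auto intro!: derivative_eq_intros)
  from diff_chain_at[OF this dA]
  have "((\<lambda>z. A (fst z, fst (snd z))) has_derivative
      (\<lambda>v. fst v * partial (1, 0) A (fst z, fst (snd z))
      + fst (snd v) * partial (0, 1) A (fst z, fst (snd z)))) (at z)"
    by (simp add: o_def)
  from partial_eq[OF this]
  show "d1 (\<lambda>z. A (fst z, fst (snd z))) z = partial (1, 0) A (fst z, fst (snd z))"
    "d2 (\<lambda>z. A (fst z, fst (snd z))) z = partial (0, 1) A (fst z, fst (snd z))"
    "d3 (\<lambda>z. A (fst z, fst (snd z))) z = 0"
    by simp_all
qed

text \<open>The prolongation of a point transformation preserves both line fields. It is a local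
  diffeomorphism, because the slope depends on \<open>p\<close> through a fractional linear function with
  determinant \<open>J\<close>, the Jacobian of the point transformation.\<close>

lemma point_equivalent_imp_line_pair_equiv:
  assumes "point_equivalent E E'"
  shows "line_pair_equiv (snd E) V_field (D_field (fst E)) (snd E') V_field (D_field (fst E'))"
proof -
  obtain Q x0 y0 p0 where E: "E = (Q, (x0, y0, p0))"
    by (metis prod_cases4)
  obtain Q' z0' where E': "E' = (Q', z0')"
    by (cases E')
  let ?z0 = "(x0, y0, p0)"
  obtain A B where AB: "smooth_near A (x0, y0)" "smooth_near B (x0, y0)"
    and J: "partial (1, 0) A (x0, y0) * partial (0, 1) B (x0, y0)
          - partial (0, 1) A (x0, y0) * partial (1, 0) B (x0, y0) \<noteq> 0"
    and al: "along A (x0, y0, p0) \<noteq> 0"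
    and z0': "prolongation A B ?z0 = z0'"
    and Q': "\<forall>\<^sub>F z in nhds ?z0. Q' (prolongation A B z) = total_D Q (new_slope A B) z / along A z"
    using assms unfolding point_equivalent_def E E' by auto
  obtain NA NB where N: "open NA" "(x0, y0) \<in> NA" "smooth_on NA A" "open NB" "(x0, y0) \<in> NB" "smooth_on NB B"
    using AB unfolding smooth_near_iff by blast
  define a where "a = (\<lambda>z :: real \<times> real \<times> real. A (fst z, fst (snd z)))"
  define b where "b = (\<lambda>z :: real \<times> real \<times> real. B (fst z, fst (snd z)))"
  define M where "M = {z :: real \<times> real \<times> real. (fst z, fst (snd z)) \<in> NA} \<inter> {z. (fst z, fst (snd z)) \<in> NB}"
  note la = smooth_on_lift_pair[OF N(1,3), folded a_def] and lb = smooth_on_lift_pair[OF N(4,6), folded b_def]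
  have M: "open M" "?z0 \<in> M"
    using la(1) lb(1) N by (auto simp: M_def)
  have ab: "smooth_on M a" "smooth_on M b"
    by (rule smooth_on_subset[OF la(2)], force simp: M_def, rule smooth_on_subset[OF lb(2)], force simp: M_def)
  have da: "d1 a z = partial (1, 0) A (fst z, fst (snd z))" "d2 a z = partial (0, 1) A (fst z, fst (snd z))"
      "d3 a z = 0" "d1 b z = partial (1, 0) B (fst z, fst (snd z))"
      "d2 b z = partial (0, 1) B (fst z, fst (snd z))" "d3 b z = 0" if "z \<in> M" for z
    using that la(3-5)[of z] lb(3-5)[of z] by (auto simp: M_def)
  have dda: "d3 (d1 f) z = 0 \<and> d3 (d2 f) z = 0" if "z \<in> M" "f = a \<or> f = b" for f z
  proof -
    have f: "smooth_on M f" "\<And>z. z \<in> M \<Longrightarrow> d3 f z = 0"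
      using that ab da by auto
    have "d3 (partial c f) z = partial c (d3 f) z" if "c \<in> Basis" for c
      using that \<open>z \<in> M\<close> by (intro partial_commute[OF M(1) f(1)]) simp_all
    moreover have "partial c (d3 f) z = 0" for c
      using partial_cong_open[OF M(1) \<open>z \<in> M\<close>, of "d3 f" "\<lambda>_. 0"] f(2) partial_eq[OF has_derivative_const]
      by simp
    ultimately show ?thesis
      by simp
  qed
  interpret E1: derivation M "smooth_on M" d1 by (rule derivation_partial[OF M(1)]) simp
  interpret E2: derivation M "smooth_on M" d2 by (rule derivation_partial[OF M(1)]) simp
  interpret E3: derivation M "smooth_on M" d3 by (rule derivation_partial[OF M(1)]) simp
  note [simp] = smooth_on_third[OF M(1)] ab
  define aa where "aa = (\<lambda>z. d1 a z + snd (snd z) * d2 a z)"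
  define ab' where "ab' = (\<lambda>z. d1 b z + snd (snd z) * d2 b z)"
  have along: "along A z = aa z" "along B z = ab' z" if "z \<in> M" for z
    using da[OF that] by (cases z; simp add: along_def aa_def ab'_def)+
  have [simp]: "smooth_on M aa" "smooth_on M ab'"
    by (simp_all add: aa_def ab'_def)
  have d3aa: "d3 aa z = d2 a z" "d3 ab' z = d2 b z" if "z \<in> M" for z
    using that dda[OF that] by (simp_all add: aa_def ab'_def partial_third)
  define M' where "M' = {z \<in> M. aa z \<in> - {0}}"
  have M': "open M'" "?z0 \<in> M'"
    using open_vimage_Int[OF M(1) smooth_on_continuous[of M aa], of "- {0}"] M(2) al along(1)[OF M(2)]
    by (auto simp: M'_def)
  have M'M: "M' \<subseteq> M"
    by (auto simp: M'_def)
  define S where "S = (\<lambda>z. ab' z / aa z)"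
  have smM': "smooth_on M' a" "smooth_on M' b" "smooth_on M' aa" "smooth_on M' ab'"
    by (rule smooth_on_subset[OF _ M'M]; simp)+
  have S: "smooth_on M' S"
    unfolding S_def by (rule smooth_on_divide[OF M'(1) _ smM'(4,3)]) (simp add: M'_def)
  define J where "J = (\<lambda>z. d1 a z * d2 b z - d2 a z * d1 b z)"
  have d3S: "d3 S z = J z / (aa z)\<^sup>2" if z: "z \<in> M'" for z
  proof -
    interpret E3': derivation M' "smooth_on M'" d3 by (rule derivation_partial[OF M'(1)]) simp
    have nz: "aa z \<noteq> 0"
      using z by (simp add: M'_def)
    have "d3 ab' z = d3 (\<lambda>z. S z * aa z) z"
      by (rule E3'.cong[OF smM'(4) smooth_on_mult[OF M'(1) S smM'(3)] _ z]) (simp add: S_def M'_def)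
    then have "d2 b z = d3 S z * aa z + S z * d2 a z"
      using z M'M S smM' d3aa[of z] by auto
    then have "d3 S z * aa z * aa z = d2 b z * aa z - ab' z * d2 a z"
      using nz by (simp add: S_def field_simps)
    also have "\<dots> = J z"
      by (simp add: J_def aa_def ab'_def algebra_simps)
    finally show ?thesis
      using nz by (simp add: field_simps power2_eq_square)
  qed
  have "smooth_on M J"
    unfolding J_def by simp
  then have evJ: "\<forall>\<^sub>F z in nhds ?z0. J z \<noteq> 0"
    using open_vimage_Int[OF M(1) smooth_on_continuous[of M J], of "- {0}"] M(2) J da[OF M(2)]
    unfolding eventually_nhds by (intro exI[of _ "{z \<in> M. J z \<in> - {0}}"]) (auto simp: J_def)
  have J0: "J ?z0 \<noteq> 0"
    using J da[OF M(2)] by (simp add: J_def)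
  have evM: "\<forall>\<^sub>F z in nhds ?z0. z \<in> M'"
    using M' by (rule eventually_nhds_in_open)
  have pro: "prolongation A B z = (a z, b z, S z)" if "z \<in> M'" for z
    using along[of z] that M'M by (cases z) (auto simp: prolongation_def new_slope_def S_def a_def b_def)
  let ?\<Phi> = "\<lambda>z. (a z, b z, S z)"
  have near: "smooth_near a ?z0" "smooth_near b ?z0" "smooth_near S ?z0"
    unfolding smooth_near_iff using M' smM' S by blast+
  have "jacobian a b S ?z0 = d3 S ?z0 * J ?z0"
    using da[OF M(2)] by (simp add: jacobian_def J_def algebra_simps)
  also have "\<dots> \<noteq> 0"
    using J0 d3S[OF M'(2)] M'(2) by (simp add: M'_def)
  finally obtain \<Xi> where L: "local_diffeo ?\<Phi> \<Xi> ?z0 (a ?z0, b ?z0, S ?z0)"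
    using local_diffeo_triple[OF near] by blast
  have z0'_eq: "(a ?z0, b ?z0, S ?z0) = z0'"
    using pro[OF M'(2)] z0' by simp
  note fd = frechet_derivative_triple[OF M'(1) smM'(1,2) S]
  have "carries ?\<Phi> ?z0 V_field V_field"
    unfolding carries_def using evJ evM
  proof eventually_elim
    case (elim z)
    have "z \<in> M"
      using elim M'M by blast
    moreover have "d3 S z \<noteq> 0"
      using elim d3S[of z] by (simp add: M'_def)
    ultimately show ?case
      using fd[OF elim(2)] da[of z] by (intro exI[of _ "d3 S z"]) (simp add: V_field_def)
  qed
  moreover have "carries ?\<Phi> ?z0 (D_field Q) (D_field Q')"
    unfolding carries_def using Q' evM
  proof eventually_elim
    case (elim z)
    have z: "z \<in> M" and nz: "aa z \<noteq> 0"
      using elim M'M by (auto simp: M'_def)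
    have "total_D Q (new_slope A B) z = total_D Q S z"
      unfolding total_D_eq
      by (subst (1 2 3) partial_cong_open[OF M'(1) elim(2), of "new_slope A B" S])
        (use along M'M in \<open>auto simp: new_slope_def S_def\<close>)
    then have "total_D Q S z = aa z * Q' (a z, b z, S z)"
      using elim(1) nz pro[OF elim(2)] along(1)[OF z] by simp
    moreover have "ab' z = aa z * S z"
      using nz by (simp add: S_def)
    ultimately show ?case
      using fd[OF elim(2), of 1 "snd (snd z)" "Q z"] da[OF z] nz
      by (intro exI[of _ "aa z"]) (simp add: D_field_def total_D_eq aa_def ab'_def)
  qed
  ultimately show ?thesis
    using L unfolding line_pair_equiv_def E E' z0'_eq by auto
qed

section \<open>Duality\<close>

text \<open>The space of \<open>n = (x, X, Y)\<close> is the common source of two local diffeomorphisms: \<open>(x, f, \<partial>f/\<partial>x)\<close> to the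
  space of the equation, and \<open>(X, Y, \<partial>F/\<partial>X)\<close> to the space of its dual. The curves on which \<open>X\<close>, \<open>Y\<close> are
  constant, spanned by \<open>\<partial>/\<partial>x\<close>, become solution curves under the first map and fibres under the
  second one; the curves on which \<open>x\<close> and \<open>f\<close> are constant behave the other way round.\<close>

lemma dual_ode_imp_line_pair_equiv:
  assumes "dual_ode E e"
  shows "line_pair_equiv (snd E) V_field (D_field (fst E)) (snd e) (D_field (fst e)) V_field"
proof -
  obtain Q x0 y0 p0 where E: "E = (Q, (x0, y0, p0))"
    by (metis prod_cases4)
  obtain q X0 Y0 P0 where e: "e = (q, (X0, Y0, P0))"
    by (metis prod_cases4)
  obtain f F where gs: "general_solution E f X0 Y0" and F: "smooth_near F (X0, x0, y0)"
    and F0: "F (X0, x0, y0) = Y0" "d1 F (X0, x0, y0) = P0"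
    and iff: "\<forall>\<^sub>F (x, y, X, Y) in nhds (x0, y0, X0, Y0). y = f (x, X, Y) \<longleftrightarrow> Y = F (X, x, y)"
    and Fq: "\<forall>\<^sub>F (X, x, y) in nhds (X0, x0, y0). d1 (d1 F) (X, x, y) = q (X, F (X, x, y), d1 F (X, x, y))"
    using assms unfolding dual_ode_def E e by auto
  let ?n0 = "(x0, X0, Y0)"
  have f: "smooth_near f ?n0" and f0: "f ?n0 = y0" "d1 f ?n0 = p0"
    and \<Delta>0: "d2 f ?n0 * d3 (d1 f) ?n0 - d3 f ?n0 * d2 (d1 f) ?n0 \<noteq> 0"
    and fQ: "\<forall>\<^sub>F (x, X, Y) in nhds ?n0. d1 (d1 f) (x, X, Y) = Q (x, f (x, X, Y), d1 f (x, X, Y))"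
    using gs unfolding general_solution_def E by auto
  obtain M0 where M0: "open M0" "?n0 \<in> M0" "smooth_on M0 f"
    using f unfolding smooth_near_iff by blast
  obtain N where N: "open N" "(X0, x0, y0) \<in> N" "smooth_on N F"
    using F unfolding smooth_near_iff by blast
  \<comment> \<open>the arguments \<open>(X, x, y)\<close> of \<open>F\<close> on the graph of \<open>y = f (x, X, Y)\<close>\<close>
  define H where "H = (\<lambda>n. (fst (snd n), fst n, f n))"
  have H0: "H ?n0 = (X0, x0, y0)"
    by (simp add: H_def f0)
  have contf: "continuous_on M0 f"
    by (rule smooth_on_continuous[OF M0(3)])
  have contH: "continuous_on M0 H"
    unfolding H_def by (intro continuous_intros contf)
  have "continuous_on M0 (\<lambda>n. (fst n, f n, snd n))"
    by (intro continuous_intros contf)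
  then have "isCont (\<lambda>n. (fst n, f n, snd n)) ?n0"
    using M0(1,2) by (simp add: continuous_on_eq_continuous_at)
  then have lim4: "filterlim (\<lambda>n. (fst n, f n, snd n)) (nhds (x0, y0, X0, Y0)) (nhds ?n0)"
    using tendsto_at_iff_tendsto_nhds[of "\<lambda>n. (fst n, f n, snd n)" ?n0] by (simp add: isCont_def f0)
  have "isCont H ?n0"
    using contH M0(1,2) by (simp add: continuous_on_eq_continuous_at)
  then have limH: "filterlim H (nhds (X0, x0, y0)) (nhds ?n0)"
    unfolding isCont_def tendsto_at_iff_tendsto_nhds by (simp add: H0)
  have ev1: "\<forall>\<^sub>F n in nhds ?n0. F (H n) = snd (snd n)"
    using eventually_compose_filterlim[OF iff lim4] by eventually_elim (auto simp: H_def)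
  have ev2: "\<forall>\<^sub>F n in nhds ?n0. d1 (d1 F) (H n) = q (fst (snd n), F (H n), d1 F (H n))"
    using eventually_compose_filterlim[OF Fq limH] by eventually_elim (simp add: H_def)
  have ev3: "\<forall>\<^sub>F n in nhds ?n0. d1 (d1 f) n = Q (fst n, f n, d1 f n)"
    using fQ by eventually_elim auto
  have ev4: "\<forall>\<^sub>F n in nhds ?n0. n \<in> {n \<in> M0. H n \<in> N}"
    using open_vimage_Int[OF M0(1) contH N(1)] M0 N H0 by (intro eventually_nhds_in_open) auto
  define \<Delta> where "\<Delta> = (\<lambda>n. d2 f n * d3 (d1 f) n - d3 f n * d2 (d1 f) n)"
  have "smooth_on M0 \<Delta>"
    unfolding \<Delta>_def
    by (intro smooth_on_diff smooth_on_mult M0 smooth_on_partial) simp_all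
  then have ev5: "\<forall>\<^sub>F n in nhds ?n0. n \<in> {n \<in> M0. \<Delta> n \<in> - {0}}"
    using open_vimage_Int[OF M0(1) smooth_on_continuous[of M0 \<Delta>], of "- {0}"] M0 \<Delta>0
    by (intro eventually_nhds_in_open) (auto simp: \<Delta>_def)
  obtain M where M: "open M" "?n0 \<in> M" and
    props: "\<And>n. n \<in> M \<Longrightarrow> F (H n) = snd (snd n) \<and> d1 (d1 F) (H n) = q (fst (snd n), F (H n), d1 F (H n))
      \<and> d1 (d1 f) n = Q (fst n, f n, d1 f n) \<and> n \<in> M0 \<and> H n \<in> N \<and> \<Delta> n \<noteq> 0"
  proof -
    have "\<forall>\<^sub>F n in nhds ?n0. F (H n) = snd (snd n) \<and> d1 (d1 F) (H n) = q (fst (snd n), F (H n), d1 F (H n))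
      \<and> d1 (d1 f) n = Q (fst n, f n, d1 f n) \<and> n \<in> M0 \<and> H n \<in> N \<and> \<Delta> n \<noteq> 0"
      using ev1 ev2 ev3 ev4 ev5 by eventually_elim auto
    then show thesis
      using that unfolding eventually_nhds by blast
  qed
  have f_M [simp]: "smooth_on M f"
    by (rule smooth_on_subset[OF M0(3)]) (use props in blast)
  note co = smooth_on_coordinates[OF M(1)]
  have HN: "(fst (snd n), fst n, f n) \<in> N" if "n \<in> M" for n
    using props[OF that] by (simp add: H_def)
  have comp: "smooth_on M (\<lambda>n. g (H n))"
    "n \<in> M \<Longrightarrow> b \<in> Basis \<Longrightarrow> partial b (\<lambda>n. g (H n)) n =
      partial b (\<lambda>n. fst (snd n)) n * d1 g (H n) + partial b fst n * d2 g (H n)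
      + partial b f n * d3 g (H n)" if "smooth_on N g" for g n b
    using smooth_on_compose_triple[OF M(1) N(1) co(2,1) f_M that HN] by (simp_all add: H_def)
  have F1: "smooth_on N (d1 F)"
    by (rule smooth_on_partial[OF N(3)]) simp
  define P where "P = (\<lambda>n. d1 F (H n))"
  have P [simp]: "smooth_on M P"
    unfolding P_def by (rule comp(1)[OF F1])
  have dP: "d1 P n = d2 (d1 F) (H n) + d1 f n * d3 (d1 F) (H n)"
      "d2 P n = d1 (d1 F) (H n) + d2 f n * d3 (d1 F) (H n)"
      "d3 P n = d3 f n * d3 (d1 F) (H n)" if "n \<in> M" for n
    using comp(2)[OF F1 that] by (simp_all add: P_def partial_coordinates)
  \<comment> \<open>differentiating the identity \<open>F (X, x, f (x, X, Y)) = Y\<close>\<close>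
  have dF: "partial b (\<lambda>n. F (H n)) n = partial b (\<lambda>n. snd (snd n)) n" if "n \<in> M" for b n
    by (rule partial_cong_open[OF M(1) that]) (use props in simp)
  have F2: "P n + d2 f n * d3 F (H n) = 0" "d3 f n * d3 F (H n) = 1" if "n \<in> M" for n
    using comp(2)[OF N(3) that, of "(0, 1, 0)"] comp(2)[OF N(3) that, of "(0, 0, 1)"]
      dF[OF that, of "(0, 1, 0)"] dF[OF that, of "(0, 0, 1)"]
    by (simp_all add: partial_coordinates P_def)
  have fY: "d3 f n \<noteq> 0" and PfY: "P n * d3 f n + d2 f n = 0" if "n \<in> M" for n
  proof -
    show "d3 f n \<noteq> 0"
      using F2(2)[OF that] by auto
    have "P n = - (d2 f n * d3 F (H n))"
      using F2(1)[OF that] by linarith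
    then have "P n * d3 f n + d2 f n = d2 f n * (1 - d3 f n * d3 F (H n))"
      by (simp add: algebra_simps)
    then show "P n * d3 f n + d2 f n = 0"
      by (simp add: F2(2)[OF that])
  qed
  interpret E1: derivation M "smooth_on M" d1 by (rule derivation_partial[OF M(1)]) simp
  interpret E2: derivation M "smooth_on M" d2 by (rule derivation_partial[OF M(1)]) simp
  interpret E3: derivation M "smooth_on M" d3 by (rule derivation_partial[OF M(1)]) simp
  have comm: "d1 (d3 f) n = d3 (d1 f) n" "d1 (d2 f) n = d2 (d1 f) n" if "n \<in> M" for n
    by (rule partial_commute[OF M(1) f_M _ _ that]; simp)+
  \<comment> \<open>differentiating \<open>P = - f\<^sub>X / f\<^sub>Y\<close> with respect to \<open>x\<close>\<close>
  have d1P: "d1 P n * d3 f n * d3 f n = \<Delta> n" if n: "n \<in> M" for n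
  proof -
    have "d1 (\<lambda>n. P n * d3 f n + d2 f n) n = d1 (\<lambda>_. 0) n"
      by (rule E1.cong) (use n PfY in simp_all)
    then have "d1 P n * d3 f n = - P n * d3 (d1 f) n - d2 (d1 f) n"
      using n comm[OF n] by simp
    then have "d1 P n * d3 f n * d3 f n = (- P n * d3 (d1 f) n - d2 (d1 f) n) * d3 f n"
      by (simp only:)
    also have "\<dots> = - (P n * d3 f n) * d3 (d1 f) n - d3 f n * d2 (d1 f) n"
      by (simp add: algebra_simps)
    also have "P n * d3 f n = - d2 f n"
      using PfY[OF n] by linarith
    finally show ?thesis
      by (simp add: \<Delta>_def)
  qed
  have d1P_nz: "d1 P n \<noteq> 0" if "n \<in> M" for n
    using d1P[OF that] props[OF that] by auto
  \<comment> \<open>\<open>T\<close> spans the kernel of \<open>(dx, df)\<close>, and \<open>e_x\<close> is the coordinate field of \<open>x\<close>\<close>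
  define T where "T = (\<lambda>n. (0 :: real, d3 f n, - d2 f n))"
  define e_x where "e_x = (\<lambda>n :: real \<times> real \<times> real. (1 :: real, 0 :: real, 0 :: real))"
  have evM: "\<forall>\<^sub>F n in nhds ?n0. n \<in> M"
    using M by (rule eventually_nhds_in_open)
  have near: "smooth_near g ?n0" if "smooth_on M g" for g
    using M that unfolding smooth_near_iff by blast

  have 1: "line_pair_equiv ?n0 T e_x (snd E) V_field (D_field Q)"
  proof -
    let ?\<Phi> = "\<lambda>n. (fst n, f n, d1 f n)"
    have sm: "smooth_on M (d1 f)"
      by simp
    have "jacobian fst f (d1 f) ?n0 \<noteq> 0"
      using \<Delta>0 partial_coordinates(1) by (simp add: jacobian_def)
    from local_diffeo_triple[OF near[OF co(1)] near[OF f_M] near[OF sm] this]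
    obtain \<Xi> where L: "local_diffeo ?\<Phi> \<Xi> ?n0 (snd E)"
      using f0 by (auto simp: E)
    note fd = frechet_derivative_triple[OF M(1) co(1) f_M sm]
    have "carries ?\<Phi> ?n0 T V_field"
      unfolding carries_def using evM
    proof eventually_elim
      case (elim n)
      then show ?case
        using fd[OF elim, of 0 "d3 f n" "- d2 f n"] props[OF elim]
        by (intro exI[of _ "- \<Delta> n"]) (simp add: T_def V_field_def \<Delta>_def partial_coordinates)
    qed
    moreover have "carries ?\<Phi> ?n0 e_x (D_field Q)"
      unfolding carries_def using evM
    proof eventually_elim
      case (elim n)
      then show ?case
        using fd[OF elim, of 1 0 0] props[OF elim]
        by (intro exI[of _ 1]) (simp add: e_x_def D_field_def partial_coordinates)
    qed
    ultimately show ?thesis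
      using L unfolding line_pair_equiv_def by blast
  qed
  have 2: "line_pair_equiv ?n0 T e_x (snd e) (D_field q) V_field"
  proof -
    let ?\<Phi> = "\<lambda>n. (fst (snd n), snd (snd n), P n)"
    have "jacobian (\<lambda>n. fst (snd n)) (\<lambda>n. snd (snd n)) P ?n0 \<noteq> 0"
      using d1P_nz[OF M(2)] by (simp add: jacobian_def partial_coordinates)
    from local_diffeo_triple[OF near[OF co(2)] near[OF co(3)] near[OF P] this]
    obtain \<Xi> where L: "local_diffeo ?\<Phi> \<Xi> ?n0 (snd e)"
      using f0 F0 by (auto simp: e P_def H_def)
    note fd = frechet_derivative_triple[OF M(1) co(2,3) P]
    have "carries ?\<Phi> ?n0 T (D_field q)"
      unfolding carries_def using evM
    proof eventually_elim
      case (elim n)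
      have 1: "d2 f n = - (d3 f n * P n)"
        using PfY[OF elim] by (simp add: algebra_simps)
      have "d3 f n * d2 P n - d2 f n * d3 P n = d3 f n * d1 (d1 F) (H n)"
        using dP[OF elim] by (simp add: algebra_simps)
      also have "\<dots> = d3 f n * q (fst (snd n), snd (snd n), P n)"
        using props[OF elim] by (simp add: P_def)
      finally show ?case
        using fd[OF elim, of 0 "d3 f n" "- d2 f n"] fY[OF elim] 1
        by (intro exI[of _ "d3 f n"]) (simp add: T_def D_field_def partial_coordinates)
    qed
    moreover have "carries ?\<Phi> ?n0 e_x V_field"
      unfolding carries_def using evM
    proof eventually_elim
      case (elim n)
      then show ?case
        using fd[OF elim, of 1 0 0] d1P_nz[OF elim]
        by (intro exI[of _ "d1 P n"]) (simp add: e_x_def V_field_def partial_coordinates)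
    qed
    ultimately show ?thesis
      using L unfolding line_pair_equiv_def by blast
  qed
  show ?thesis
    using line_pair_equiv_trans[OF line_pair_equiv_sym[OF 1] 2] by (simp add: E e)
qed

section \<open>Duality of the relative invariants\<close>

theorem proposition2:
  fixes E :: ode
  assumes "is_ode E"
    and "vanishes w2 E"
    and "nowhere_zero w1 E"
  shows "\<forall>e \<in> dual_class (point_class E). nowhere_zero w2 e \<and> vanishes w1 e"
proof
  fix e' assume "e' \<in> dual_class (point_class E)"
  then obtain E1 e where pE: "point_equivalent E E1" and dual: "dual_ode E1 e" and pe: "point_equivalent e e'"
    unfolding dual_class_def point_class_def by blast
  have web: "line_pair_equiv (snd E) V_field (D_field (fst E)) (snd e') (D_field (fst e')) V_field"
    by (rule line_pair_equiv_trans[OF line_pair_equiv_trans[OF point_equivalent_imp_line_pair_equiv[OF pE]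
          dual_ode_imp_line_pair_equiv[OF dual]] line_pair_equiv_swap[OF point_equivalent_imp_line_pair_equiv[OF pe]]])
  have sm: "smooth_near (fst E) (snd E)" "smooth_near (fst e') (snd e')"
    using assms(1) pe by (auto simp: is_ode_def point_equivalent_def)
  obtain \<Phi> \<Xi> where L: "local_diffeo \<Phi> \<Xi> (snd E) (snd e')"
    and 1: "\<forall>\<^sub>F z in nhds (snd E). \<exists>c. c \<noteq> 0 \<and> w2 (fst e') (\<Phi> z) = c * w1 (fst E) z"
    using w2_dual_multiple_of_w1[OF web sm] .
  have "\<forall>\<^sub>F z in nhds (snd E). w2 (fst e') (\<Phi> z) \<noteq> 0"
    using 1 assms(3)[unfolded nowhere_zero_def] by eventually_elim auto
  from eventually_compose_filterlim[OF this local_diffeo_filterlim[OF local_diffeo_sym[OF L]]]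
  have "\<forall>\<^sub>F w in nhds (snd e'). w2 (fst e') (\<Phi> (\<Xi> w)) \<noteq> 0" .
  moreover have "\<forall>\<^sub>F w in nhds (snd e'). \<Phi> (\<Xi> w) = w"
    using L by (simp add: local_diffeo_def)
  ultimately have nz: "nowhere_zero w2 e'"
    unfolding nowhere_zero_def by eventually_elim simp
  obtain \<Phi>' \<Xi>' where L': "local_diffeo \<Phi>' \<Xi>' (snd e') (snd E)"
    and 2: "\<forall>\<^sub>F w in nhds (snd e'). \<exists>c. c \<noteq> 0 \<and> w2 (fst E) (\<Phi>' w) = c * w1 (fst e') w"
    using w2_dual_multiple_of_w1[OF line_pair_equiv_swap[OF line_pair_equiv_sym[OF web]] sm(2,1)] .
  have "\<forall>\<^sub>F w in nhds (snd e'). w2 (fst E) (\<Phi>' w) = 0"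
    by (rule eventually_compose_filterlim[OF assms(2)[unfolded vanishes_def] local_diffeo_filterlim[OF L']])
  with 2 have "vanishes w1 e'"
    unfolding vanishes_def by eventually_elim auto
  with nz show "nowhere_zero w2 e' \<and> vanishes w1 e'" ..
qed

end
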